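(* Let $\mathcal C$ be a symmetric monoidal category and let $\kappa_n:\mathrm{Ob}\,\mathcal C^n\to\mathrm{Ob}\,Y(n)$, $n\ge 0$, be an arbitrary sequence of functions. Then the sets $U_\kappa\mathcal C(\mathbf x;y)=\mathcal C(\bar\kappa\mathbf x,y)$ (for $n\ge0$, $\mathbf x\in\mathrm{Ob}\,\mathcal C^n$, $y\in\mathrm{Ob}\,\mathcal C$), together with the identity elements, the symmetric group actions $\sigma^*$ and the composition multiproduct $\Gamma$ described in the context, form a multicategory $U_\kappa\mathcal C$ whose objects are the objects of $\mathcal C$.
   Context: "Multicategory" means symmetric multicategory: a class of objects, sets of $n$-morphisms $M(x_1,\dots,x_n;y)$ for all $n\ge0$, right actions $\sigma^*:M(\mathbf x;y)\to M(\sigma^{-1}\mathbf x;y)$ for $\sigma\in\Sigma_n$, where $\sigma^{-1}\mathbf x=(x_{\sigma(1)},\dots,x_{\sigma(n)})$, units $1_a\in M(a;a)$, and a multiproduct $\Gamma:M(\mathbf y;z)\times\prod_{s=1}^nM(\mathbf x_s;y_s)\to M(\odot_s\mathbf x_s;z)$ ($\odot$ denotes concatenation of tuples), which is associative, unital, and equivariant in the two usual operadic senses. A symmetric monoidal category $(\mathcal C,\oplus,e_{\mathcal C})$ has unit isomorphism $c:a\oplus e_{\mathcal C}\to a$, associator $\alpha:(a\oplus b)\oplus c\to a\oplus(b\oplus c)$ and symmetry $\tau:a\oplus b\to b\oplus a$, natural and coherent. The categorical operad $Y$. The objects of $Y$ form the free symmetric operad of sets on a generator $0$ of arity $0$ and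 a generator $m$ of arity $2$. Concretely an object $w$ of $Y(n)$ is a complete binary parenthesization of a list of $k\ge\max(n,1)$ slots, with the variables $x_1,\dots,x_n$ placed each exactly once, in any order, in $n$ of the slots, and the remaining slots filled by the symbol $e$. The operad unit $1\in Y(1)$ is the word $x_1$; $0\in Y(0)$ is the word $e$; $m\in Y(2)$ is the word $x_1\oplus x_2$. Between any two objects of $Y(n)$ there is exactly one morphism, which is therefore an isomorphism. $Y$ acts on every symmetric monoidal category $\mathcal C$: an object $w\in Y(n)$ gives the functor $w:\mathcal C^n\to\mathcal C$ evaluating the word (with $\oplus$ the monoidal product and $e$ sent to $e_{\mathcal C}$), and the unique morphism $w\to w'$ gives the canonical natural isomorphism of functors $\mathcal C^n\to\mathcal C$ built from $\alpha$, $c$, $\tau$ and inverses (unique by coherence). The operad composition $\gamma$ of $Y$ is substitution, so $\gamma(w;w_1,\dots,w_n)(\odot_s\mathbf x_s)=w(w_1(\mathbf x_1),\dots,w_n(\mathbf x_n))$, and the right $\Sigma_n$-action on $Y(n)$ satisfies $(w\cdot\sigma)(\sigma^{-1}\mathbf x)=w(\mathbf x)$. Structure of $U_\kappa\mathcal C$. For $\mathbf x\in\mathrm{Ob}\,\mathcal C^n$ put $\bar\kappa\mathbf x=\kappa_n(\mathbf x)(\mathbf x)\in\mathrm{Ob}\,\mathcal C$, the word $\kappa_n(\mathbf x)$ evaluated at $\mathbf x$. The objects of $U_\kappa\mathcal C$ are those of $\mathcal C$, and $U_\kappa\mathcal C(\mathbf x;y)=\mathcal C(\bar\kappa\mathbf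 x,y)$, where elements are understood to be tagged with the source tuple $\mathbf x$, so that morphism sets with different source tuples are disjoint. - Identities: the identity in $U_\kappa\mathcal C(a;a)=\mathcal C(\bar\kappa(a),a)$ is the map $\omega(a)$ induced by the unique isomorphism $\kappa_1(a)\to1$ in $Y(1)$, evaluated at $a$. - Symmetric group action: for $\sigma\in\Sigma_n$ let $\theta(\mathbf x,\sigma):\bar\kappa(\sigma^{-1}\mathbf x)\to(\kappa_n(\mathbf x)\cdot\sigma)(\sigma^{-1}\mathbf x)=\bar\kappa\mathbf x$ be induced by the unique isomorphism $\kappa_n(\sigma^{-1}\mathbf x)\to\kappa_n(\mathbf x)\cdot\sigma$ in $Y(n)$; then $\sigma^*f=f\circ\theta(\mathbf x,\sigma)$. - Composition: for $\mathbf y=(y_1,\dots,y_n)$ and $j_s$-tuples $\mathbf x_s$ with $j=\sum_s j_s$, let $\phi:\bar\kappa(\odot_s\mathbf x_s)\to\kappa_n(\mathbf y)(\bar\kappa\mathbf x_1,\dots,\bar\kappa\mathbf x_n)$ be induced by the unique isomorphism $\kappa_j(\odot_s\mathbf x_s)\to\gamma(\kappa_n(\mathbf y);\kappa_{j_1}(\mathbf x_1),\dots,\kappa_{j_n}(\mathbf x_n))$ in $Y(j)$. For $g\in\mathcal C(\bar\kappa\mathbf y,z)$ and $f_s\in\mathcal C(\bar\kappa\mathbf x_s,y_s)$, $\Gamma(g;f_1,\dots,f_n)=g\circ\kappa_n(\mathbf y)(f_1,\dots,f_n)\circ\phi$. *)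

theory Defs
  imports Main "HOL-Combinatorics.Permutations"
begin

section \<open>Symmetric monoidal categories\<close>

text \<open>
  Hom-sets are families indexed by the objects of a carrier and are pairwise disjoint, so
  composition needs no object indices. \<open>g \<cdot> f\<close> is "g after f".
\<close>

record ('o, 'a) cat_data =
  obj :: "'o set"
  hom :: "'o \<Rightarrow> 'o \<Rightarrow> 'a set"
  ident :: "'o \<Rightarrow> 'a"
  cmp :: "'a \<Rightarrow> 'a \<Rightarrow> 'a" (infixr "\<cdot>\<index>" 70)

locale category =
  fixes C :: "('o, 'a, 'z) cat_data_scheme" (structure)
  assumes hom_obj: "f \<in> hom C a b \<Longrightarrow> a \<in> obj C \<and> b \<in> obj C"
    and hom_disjoint: "f \<in> hom C a b \<Longrightarrow> f \<in> hom C a' b' \<Longrightarrow> a = a' \<and> b = b'"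
    and ident_hom: "a \<in> obj C \<Longrightarrow> ident C a \<in> hom C a a"
    and cmp_hom: "f \<in> hom C a b \<Longrightarrow> g \<in> hom C b c \<Longrightarrow> g \<cdot> f \<in> hom C a c"
    and cmp_ident_left: "f \<in> hom C a b \<Longrightarrow> ident C b \<cdot> f = f"
    and cmp_ident_right: "f \<in> hom C a b \<Longrightarrow> f \<cdot> ident C a = f"
    and cmp_assoc: "f \<in> hom C a b \<Longrightarrow> g \<in> hom C b c \<Longrightarrow> h \<in> hom C c d \<Longrightarrow>
      (h \<cdot> g) \<cdot> f = h \<cdot> (g \<cdot> f)"

definition inverse_of :: "('o, 'a, 'z) cat_data_scheme \<Rightarrow> 'o \<Rightarrow> 'o \<Rightarrow> 'a \<Rightarrow> 'a \<Rightarrow> bool" where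
  "inverse_of C a b f g \<longleftrightarrow> f \<in> hom C a b \<and> g \<in> hom C b a \<and>
     g \<cdot>\<^bsub>C\<^esub> f = ident C a \<and> f \<cdot>\<^bsub>C\<^esub> g = ident C b"

definition iso :: "('o, 'a, 'z) cat_data_scheme \<Rightarrow> 'o \<Rightarrow> 'o \<Rightarrow> 'a \<Rightarrow> bool" where
  "iso C a b f \<longleftrightarrow> (\<exists>g. inverse_of C a b f g)"

definition inverse_arrow :: "('o, 'a, 'z) cat_data_scheme \<Rightarrow> 'o \<Rightarrow> 'o \<Rightarrow> 'a \<Rightarrow> 'a" where
  "inverse_arrow C a b f = (THE g. inverse_of C a b f g)"

record ('o, 'a) smc_data = "('o, 'a) cat_data" +
  tens_obj :: "'o \<Rightarrow> 'o \<Rightarrow> 'o" (infixr "\<oplus>\<index>" 75)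
  tens_arr :: "'a \<Rightarrow> 'a \<Rightarrow> 'a" (infixr "\<otimes>\<index>" 75)
  unit_obj :: "'o" ("\<e>\<index>")
  runit :: "'o \<Rightarrow> 'a"
  assoc :: "'o \<Rightarrow> 'o \<Rightarrow> 'o \<Rightarrow> 'a"
  symm :: "'o \<Rightarrow> 'o \<Rightarrow> 'a"

text \<open>
  Only the right unit isomorphism \<open>c\<close> is a primitive; the left unit isomorphism is
  \<open>c b \<cdot> \<tau> e b\<close>, and this is how it occurs in the triangle axiom. Coherence is imposed
  by Mac Lane's finite list of axioms: triangle, pentagon, hexagon and \<open>\<tau> \<cdot> \<tau> = 1\<close>.
\<close>

locale symmetric_monoidal_category = category C
  for C :: "('o, 'a) smc_data" (structure) +
  assumes unit_obj: "\<e> \<in> obj C"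
    and tens_obj: "a \<in> obj C \<Longrightarrow> b \<in> obj C \<Longrightarrow> a \<oplus> b \<in> obj C"
    and tens_hom: "f \<in> hom C a b \<Longrightarrow> f' \<in> hom C a' b' \<Longrightarrow> f \<otimes> f' \<in> hom C (a \<oplus> a') (b \<oplus> b')"
    and tens_ident: "a \<in> obj C \<Longrightarrow> b \<in> obj C \<Longrightarrow> ident C a \<otimes> ident C b = ident C (a \<oplus> b)"
    and tens_cmp: "f \<in> hom C a b \<Longrightarrow> g \<in> hom C b c \<Longrightarrow> f' \<in> hom C a' b' \<Longrightarrow> g' \<in> hom C b' c' \<Longrightarrow>
      (g \<cdot> f) \<otimes> (g' \<cdot> f') = (g \<otimes> g') \<cdot> (f \<otimes> f')"
    and runit_iso: "a \<in> obj C \<Longrightarrow> iso C (a \<oplus> \<e>) a (runit C a)"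
    and runit_natural: "f \<in> hom C a b \<Longrightarrow> runit C b \<cdot> (f \<otimes> ident C \<e>) = f \<cdot> runit C a"
    and assoc_iso: "a \<in> obj C \<Longrightarrow> b \<in> obj C \<Longrightarrow> c \<in> obj C \<Longrightarrow>
      iso C ((a \<oplus> b) \<oplus> c) (a \<oplus> (b \<oplus> c)) (assoc C a b c)"
    and assoc_natural: "f \<in> hom C a a' \<Longrightarrow> g \<in> hom C b b' \<Longrightarrow> h \<in> hom C c c' \<Longrightarrow>
      assoc C a' b' c' \<cdot> ((f \<otimes> g) \<otimes> h) = (f \<otimes> (g \<otimes> h)) \<cdot> assoc C a b c"
    and symm_hom: "a \<in> obj C \<Longrightarrow> b \<in> obj C \<Longrightarrow> symm C a b \<in> hom C (a \<oplus> b) (b \<oplus> a)"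
    and symm_natural: "f \<in> hom C a a' \<Longrightarrow> g \<in> hom C b b' \<Longrightarrow>
      symm C a' b' \<cdot> (f \<otimes> g) = (g \<otimes> f) \<cdot> symm C a b"
    and symm_symm: "a \<in> obj C \<Longrightarrow> b \<in> obj C \<Longrightarrow> symm C b a \<cdot> symm C a b = ident C (a \<oplus> b)"
    and triangle: "a \<in> obj C \<Longrightarrow> b \<in> obj C \<Longrightarrow>
      (ident C a \<otimes> (runit C b \<cdot> symm C \<e> b)) \<cdot> assoc C a \<e> b = runit C a \<otimes> ident C b"
    and pentagon: "a \<in> obj C \<Longrightarrow> b \<in> obj C \<Longrightarrow> c \<in> obj C \<Longrightarrow> d \<in> obj C \<Longrightarrow>
      (ident C a \<otimes> assoc C b c d) \<cdot> assoc C a (b \<oplus> c) d \<cdot> (assoc C a b c \<otimes> ident C d) =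
      assoc C a b (c \<oplus> d) \<cdot> assoc C (a \<oplus> b) c d"
    and hexagon: "a \<in> obj C \<Longrightarrow> b \<in> obj C \<Longrightarrow> c \<in> obj C \<Longrightarrow>
      assoc C b c a \<cdot> symm C a (b \<oplus> c) \<cdot> assoc C a b c =
      (ident C b \<otimes> symm C a c) \<cdot> assoc C b a c \<cdot> (symm C a b \<otimes> ident C c)"


section \<open>The categorical operad Y\<close>

text \<open>
  The variables \<open>x\<^sub>1, \<dots>, x\<^sub>n\<close> are \<open>Var 0, \<dots>, Var (n - 1)\<close>; all indices start at 0.
\<close>

datatype 'v word = Var 'v | E | Plus "'v word" "'v word"

primrec vars :: "'v word \<Rightarrow> 'v list" where
  "vars (Var v) = [v]"
| "vars E = []"
| "vars (Plus u w) = vars u @ vars w"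

definition Y :: "nat \<Rightarrow> nat word set" where
  "Y n = {w. distinct (vars w) \<and> set (vars w) = {..<n}}"

definition operad_unit :: "nat word" where
  "operad_unit = Var 0"

definition arity :: "nat word \<Rightarrow> nat" where
  "arity w = length (vars w)"

primrec subst :: "('v \<Rightarrow> 'u word) \<Rightarrow> 'v word \<Rightarrow> 'u word" where
  "subst \<rho> (Var v) = \<rho> v"
| "subst \<rho> E = E"
| "subst \<rho> (Plus u w) = Plus (subst \<rho> u) (subst \<rho> w)"

text \<open>
  \<open>offset js s\<close> is the position at which block \<open>s\<close> starts in a concatenation of
  blocks of lengths \<open>js\<close>.
\<close>

definition offset :: "nat list \<Rightarrow> nat \<Rightarrow> nat" where
  "offset js s = sum_list (take s js)"

definition operad_comp :: "nat word \<Rightarrow> nat word list \<Rightarrow> nat word" where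
  "operad_comp w ws =
     subst (\<lambda>s. map_word (\<lambda>i. offset (map arity ws) s + i) (ws ! s)) w"

text \<open>
  As \<open>\<sigma>\<inverse>\<close> applied to a tuple \<open>xs\<close> is \<open>permute_list \<sigma> xs\<close>, with entry
  \<open>xs ! \<sigma> i\<close> at \<open>i\<close>, the requirement that \<open>w \<cdot> \<sigma>\<close> at \<open>\<sigma>\<inverse> xs\<close> be \<open>w\<close> at \<open>xs\<close>
  forces \<open>w \<cdot> \<sigma>\<close> to rename the variable \<open>i\<close> to \<open>inv \<sigma> i\<close>.
\<close>

definition operad_act :: "nat word \<Rightarrow> (nat \<Rightarrow> nat) \<Rightarrow> nat word" where
  "operad_act w \<sigma> = map_word (inv \<sigma>) w"


section \<open>The action of Y on a symmetric monoidal category\<close>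

primrec eval_obj :: "('o, 'a) smc_data \<Rightarrow> nat word \<Rightarrow> 'o list \<Rightarrow> 'o" where
  "eval_obj C (Var i) xs = xs ! i"
| "eval_obj C E xs = unit_obj C"
| "eval_obj C (Plus u w) xs = eval_obj C u xs \<oplus>\<^bsub>C\<^esub> eval_obj C w xs"

primrec eval_arr :: "('o, 'a) smc_data \<Rightarrow> nat word \<Rightarrow> 'a list \<Rightarrow> 'a" where
  "eval_arr C (Var i) fs = fs ! i"
| "eval_arr C E fs = ident C (unit_obj C)"
| "eval_arr C (Plus u w) fs = eval_arr C u fs \<otimes>\<^bsub>C\<^esub> eval_arr C w fs"

text \<open>
  \<open>canonical C w w' \<eta>\<close>: the family \<open>\<eta>\<close>, with components \<open>\<eta> xs\<close> from \<open>w\<close> at \<open>xs\<close> to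
  \<open>w'\<close> at \<open>xs\<close>, is built from the associator, the unit isomorphism, the symmetry and
  inverses by composition and monoidal product.
\<close>

inductive canonical ::
  "('o, 'a) smc_data \<Rightarrow> nat word \<Rightarrow> nat word \<Rightarrow> ('o list \<Rightarrow> 'a) \<Rightarrow> bool"
  for C :: "('o, 'a) smc_data" (structure) where
  ident: "canonical C w w (\<lambda>xs. ident C (eval_obj C w xs))"
| cmp: "canonical C u v \<eta> \<Longrightarrow> canonical C v w \<theta> \<Longrightarrow> canonical C u w (\<lambda>xs. \<theta> xs \<cdot> \<eta> xs)"
| tens: "canonical C u u' \<eta> \<Longrightarrow> canonical C v v' \<theta> \<Longrightarrow>
    canonical C (Plus u v) (Plus u' v') (\<lambda>xs. \<eta> xs \<otimes> \<theta> xs)"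
| inverse: "canonical C u v \<eta> \<Longrightarrow>
    canonical C v u (\<lambda>xs. inverse_arrow C (eval_obj C u xs) (eval_obj C v xs) (\<eta> xs))"
| runit: "canonical C (Plus u E) u (\<lambda>xs. runit C (eval_obj C u xs))"
| assoc: "canonical C (Plus (Plus u v) w) (Plus u (Plus v w))
    (\<lambda>xs. assoc C (eval_obj C u xs) (eval_obj C v xs) (eval_obj C w xs))"
| symm: "canonical C (Plus u v) (Plus v u) (\<lambda>xs. symm C (eval_obj C u xs) (eval_obj C v xs))"

text \<open>
  The component at \<open>xs\<close> of the natural isomorphism given by the unique morphism
  \<open>w \<rightarrow> w'\<close> of \<open>Y n\<close>. It exists and is unique, by coherence, when \<open>w\<close> and \<open>w'\<close> are in
  \<open>Y n\<close> and \<open>xs\<close> is an \<open>n\<close>-tuple of objects.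
\<close>

definition canonical_iso :: "('o, 'a) smc_data \<Rightarrow> nat word \<Rightarrow> nat word \<Rightarrow> 'o list \<Rightarrow> 'a" where
  "canonical_iso C w w' xs = (THE f. \<exists>\<eta>. canonical C w w' \<eta> \<and> f = \<eta> xs)"


section \<open>Symmetric multicategories\<close>

text \<open>
  Sources of multimorphisms are lists of objects. The action \<open>mact M \<sigma>\<close> is the right action
  \<open>\<sigma>\<^sup>*\<close>, for \<open>\<sigma>\<close> a permutation of \<open>{..<n}\<close>, and \<open>mcomp M g fs\<close> is the multiproduct.
  As for categories, the sets of multimorphisms are pairwise disjoint.
\<close>

record ('o, 'm) multicat_data =
  mobj :: "'o set"
  mhom :: "'o list \<Rightarrow> 'o \<Rightarrow> 'm set"
  munit :: "'o \<Rightarrow> 'm"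
  mact :: "(nat \<Rightarrow> nat) \<Rightarrow> 'm \<Rightarrow> 'm"
  mcomp :: "'m \<Rightarrow> 'm list \<Rightarrow> 'm"

definition mhoms :: "('o, 'm) multicat_data \<Rightarrow> 'o list list \<Rightarrow> 'o list \<Rightarrow> 'm list set" where
  "mhoms M xss ys = {fs. length xss = length ys \<and> length fs = length ys \<and>
     (\<forall>s < length ys. fs ! s \<in> mhom M (xss ! s) (ys ! s))}"

text \<open>
  \<open>block_perm \<sigma> js\<close> permutes blocks of lengths \<open>js\<close> as \<open>\<sigma>\<close> permutes their indices, so that
  \<open>permute_list (block_perm \<sigma> (map length xss)) (concat xss) = concat (permute_list \<sigma> xss)\<close>.
  \<open>sum_perm \<tau>s js\<close> is the direct sum of permutations \<open>\<tau>s ! s\<close> of \<open>{..<js ! s}\<close>. Both are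
  the identity outside \<open>{..<sum_list js}\<close>.
\<close>

definition block_perm :: "(nat \<Rightarrow> nat) \<Rightarrow> nat list \<Rightarrow> nat \<Rightarrow> nat" where
  "block_perm \<sigma> js p =
     (if p < sum_list js
      then concat (map (\<lambda>s. map (\<lambda>r. offset js (\<sigma> s) + r) [0..<js ! \<sigma> s]) [0..<length js]) ! p
      else p)"

definition sum_perm :: "(nat \<Rightarrow> nat) list \<Rightarrow> nat list \<Rightarrow> nat \<Rightarrow> nat" where
  "sum_perm \<tau>s js p =
     (if p < sum_list js
      then concat (map (\<lambda>s. map (\<lambda>r. offset js s + (\<tau>s ! s) r) [0..<js ! s]) [0..<length js]) ! p
      else p)"

locale multicategory =
  fixes M :: "('o, 'm) multicat_data"
  assumes mhom_obj: "f \<in> mhom M xs y \<Longrightarrow> set xs \<subseteq> mobj M \<and> y \<in> mobj M"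
    and mhom_disjoint: "f \<in> mhom M xs y \<Longrightarrow> f \<in> mhom M xs' y' \<Longrightarrow> xs = xs' \<and> y = y'"
    and munit_mhom: "a \<in> mobj M \<Longrightarrow> munit M a \<in> mhom M [a] a"
    and mact_mhom: "f \<in> mhom M xs y \<Longrightarrow> \<sigma> permutes {..<length xs} \<Longrightarrow>
      mact M \<sigma> f \<in> mhom M (permute_list \<sigma> xs) y"
    and mcomp_mhom: "g \<in> mhom M ys z \<Longrightarrow> fs \<in> mhoms M xss ys \<Longrightarrow>
      mcomp M g fs \<in> mhom M (concat xss) z"
    and mact_id: "f \<in> mhom M xs y \<Longrightarrow> mact M id f = f"
    and mact_mact: "f \<in> mhom M xs y \<Longrightarrow> \<sigma> permutes {..<length xs} \<Longrightarrow>
      \<tau> permutes {..<length xs} \<Longrightarrow> mact M \<tau> (mact M \<sigma> f) = mact M (\<sigma> \<circ> \<tau>) f"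
    and mcomp_munit_left: "f \<in> mhom M xs y \<Longrightarrow> mcomp M (munit M y) [f] = f"
    and mcomp_munit_right: "f \<in> mhom M xs y \<Longrightarrow> mcomp M f (map (munit M) xs) = f"
    and mcomp_assoc: "h \<in> mhom M zs w \<Longrightarrow> gs \<in> mhoms M yss zs \<Longrightarrow>
      length xsss = length yss \<Longrightarrow> length fss = length yss \<Longrightarrow>
      (\<And>s. s < length yss \<Longrightarrow> fss ! s \<in> mhoms M (xsss ! s) (yss ! s)) \<Longrightarrow>
      mcomp M (mcomp M h gs) (concat fss) = mcomp M h (map2 (mcomp M) gs fss)"
    and mcomp_mact_outer: "g \<in> mhom M ys z \<Longrightarrow> fs \<in> mhoms M xss ys \<Longrightarrow>
      \<sigma> permutes {..<length ys} \<Longrightarrow>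
      mcomp M (mact M \<sigma> g) (permute_list \<sigma> fs) =
      mact M (block_perm \<sigma> (map length xss)) (mcomp M g fs)"
    and mcomp_mact_inner: "g \<in> mhom M ys z \<Longrightarrow> fs \<in> mhoms M xss ys \<Longrightarrow>
      length \<tau>s = length xss \<Longrightarrow>
      (\<And>s. s < length xss \<Longrightarrow> \<tau>s ! s permutes {..<length (xss ! s)}) \<Longrightarrow>
      mcomp M g (map2 (mact M) \<tau>s fs) =
      mact M (sum_perm \<tau>s (map length xss)) (mcomp M g fs)"


section \<open>The multicategory of a symmetric monoidal category and a choice of words\<close>

definition kword :: "(nat \<Rightarrow> 'o list \<Rightarrow> nat word) \<Rightarrow> 'o list \<Rightarrow> nat word" where
  "kword \<kappa> xs = \<kappa> (length xs) xs"

definition kbar :: "('o, 'a) smc_data \<Rightarrow> (nat \<Rightarrow> 'o list \<Rightarrow> nat word) \<Rightarrow> 'o list \<Rightarrow> 'o" where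
  "kbar C \<kappa> xs = eval_obj C (kword \<kappa> xs) xs"

definition U_unit :: "('o, 'a) smc_data \<Rightarrow> (nat \<Rightarrow> 'o list \<Rightarrow> nat word) \<Rightarrow> 'o \<Rightarrow> 'a" where
  "U_unit C \<kappa> a = canonical_iso C (kword \<kappa> [a]) operad_unit [a]"

definition U_theta ::
  "('o, 'a) smc_data \<Rightarrow> (nat \<Rightarrow> 'o list \<Rightarrow> nat word) \<Rightarrow> 'o list \<Rightarrow> (nat \<Rightarrow> nat) \<Rightarrow> 'a" where
  "U_theta C \<kappa> xs \<sigma> =
     canonical_iso C (kword \<kappa> (permute_list \<sigma> xs)) (operad_act (kword \<kappa> xs) \<sigma>)
       (permute_list \<sigma> xs)"

definition U_phi ::
  "('o, 'a) smc_data \<Rightarrow> (nat \<Rightarrow> 'o list \<Rightarrow> nat word) \<Rightarrow> 'o list list \<Rightarrow> 'o list \<Rightarrow> 'a" where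
  "U_phi C \<kappa> xss ys =
     canonical_iso C (kword \<kappa> (concat xss))
       (operad_comp (kword \<kappa> ys) (map (kword \<kappa>) xss)) (concat xss)"

text \<open>
  A multimorphism is a pair of its source tuple and an arrow of \<open>C\<close>. The tuple \<open>ys\<close> that
  \<open>\<phi>\<close> depends on is the tag of the outer multimorphism.
\<close>

definition U_multicat ::
  "('o, 'a) smc_data \<Rightarrow> (nat \<Rightarrow> 'o list \<Rightarrow> nat word) \<Rightarrow> ('o, 'o list \<times> 'a) multicat_data" where
  "U_multicat C \<kappa> = \<lparr>
     mobj = obj C,
     mhom = (\<lambda>xs y. {(xs, f) | f. set xs \<subseteq> obj C \<and> y \<in> obj C \<and> f \<in> hom C (kbar C \<kappa> xs) y}),
     munit = (\<lambda>a. ([a], U_unit C \<kappa> a)),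
     mact = (\<lambda>\<sigma> (xs, f). (permute_list \<sigma> xs, f \<cdot>\<^bsub>C\<^esub> U_theta C \<kappa> xs \<sigma>)),
     mcomp = (\<lambda>(ys, g) fs.
       (concat (map fst fs),
        g \<cdot>\<^bsub>C\<^esub> eval_arr C (kword \<kappa> ys) (map snd fs) \<cdot>\<^bsub>C\<^esub> U_phi C \<kappa> (map fst fs) ys)) \<rparr>"

end

theory Submission
  imports Defs
begin

text \<open>
  Every axiom of a multicategory asks that two arrows of \<open>C\<close> agree. After the naturality of the
  canonical isomorphisms and the functoriality of \<open>\<oplus>\<close> have moved the given arrows to the left,
  what remains on either side is a composite of canonical isomorphisms between the same two
  words, and the axiom is Mac Lane's coherence theorem for symmetric monoidal categories
  together with an identity between words: \<open>Y\<close> is associative, unital and equivariant. So there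
  are three ingredients: coherence (\<open>canonical_unique\<close>, \<open>canonical_exists\<close>), the behaviour of
  canonical isomorphisms under naturality and substitution (\<open>coh_natural\<close>, \<open>coh_comp_outer\<close>,
  \<open>coh_comp_inner\<close>, \<open>coh_act\<close>), and the operad laws for words (\<open>operad_comp_assoc\<close>,
  \<open>operad_comp_act_outer\<close>, \<open>operad_comp_act_inner\<close>).

  Uniqueness of canonical arrows is proved by setting the variables to the unit object, one at a
  time. If the variable \<open>i\<close>, with value \<open>x\<close>, occurs in a word \<open>u\<close>, then it can be moved to the
  front by an isomorphism from \<open>u\<close> at \<open>xs\<close> to \<open>x \<oplus> u'\<close>, where \<open>u'\<close> is \<open>u\<close> at the tuple
  \<open>xs[i := \<e>]\<close>. Each canonical family \<open>\<eta>\<close> commutes with these isomorphisms: \<open>\<eta>\<close> at \<open>xs\<close>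
  corresponds to \<open>1 \<otimes> \<eta>\<close> at \<open>xs[i := \<e>]\<close>. Hence \<open>\<eta>\<close> at \<open>xs\<close> is determined by \<open>\<eta>\<close> at
  \<open>xs[i := \<e>]\<close>, and after finitely many steps by its value at a tuple of units. There all words
  are collapsed to \<open>\<e>\<close> by isomorphisms with which every canonical arrow commutes, so nothing is
  left to choose.

  No presentation of the symmetric groups enters, and few diagrams have to be checked. For the
  associator, the pentagon handles a variable in the first of the three words, and the hexagon
  reduces the other two positions to that one; the symmetry is handled by the definition of the
  isomorphisms; the unit isomorphism needs \<open>(1 \<otimes> \<rho>) \<cdot> \<alpha> = \<rho>\<close>, Kelly's consequence of the axioms.
  At the unit object everything follows from the equality of the two unit isomorphisms of \<open>\<e>\<close>.
\<close>

section \<open>Categories\<close>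

context category begin

text \<open>
  Hom-sets are disjoint, so an arrow determines its source and its target. With \<open>src\<close> and \<open>trg\<close>
  as functions the typing conditions of the category laws have no variables besides the arrows
  themselves, and the simplifier can discharge them.
\<close>

definition arr :: "'a \<Rightarrow> bool" where
  "arr f \<longleftrightarrow> (\<exists>a b. f \<in> hom C a b)"
definition src :: "'a \<Rightarrow> 'o" where
  "src f = (THE a. \<exists>b. f \<in> hom C a b)"
definition trg :: "'a \<Rightarrow> 'o" where
  "trg f = (THE b. \<exists>a. f \<in> hom C a b)"

lemma hom_iff: "f \<in> hom C a b \<longleftrightarrow> arr f \<and> src f = a \<and> trg f = b"
proof
  assume f: "f \<in> hom C a b"
  then have "src f = a" "trg f = b"
    unfolding src_def trg_def using hom_disjoint by (blast intro!: the_equality)+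
  with f show "arr f \<and> src f = a \<and> trg f = b" by (auto simp: arr_def)
next
  assume *: "arr f \<and> src f = a \<and> trg f = b"
  then obtain a' b' where f: "f \<in> hom C a' b'" by (auto simp: arr_def)
  then have "src f = a'" "trg f = b'"
    unfolding src_def trg_def using hom_disjoint by (blast intro!: the_equality)+
  with * f show "f \<in> hom C a b" by simp
qed

lemma arr_hom: "arr f \<Longrightarrow> f \<in> hom C (src f) (trg f)"
  by (simp add: hom_iff)

lemma src_obj [simp]: "arr f \<Longrightarrow> src f \<in> obj C"
  and trg_obj [simp]: "arr f \<Longrightarrow> trg f \<in> obj C"
  using arr_hom hom_obj by blast+

lemma ident_typed [simp]:
  assumes "a \<in> obj C"
  shows "arr (ident C a)" "src (ident C a) = a" "trg (ident C a) = a"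
  using ident_hom[OF assms] by (simp_all add: hom_iff)

lemma cmp_typed [simp]:
  assumes "arr f" "arr g" "trg f = src g"
  shows "arr (g \<cdot> f)" "src (g \<cdot> f) = src f" "trg (g \<cdot> f) = trg g"
  using cmp_hom[of f "src f" "src g" g "trg g"] assms by (simp_all add: hom_iff)

lemma ident_cmp [simp]: "arr f \<Longrightarrow> trg f = b \<Longrightarrow> ident C b \<cdot> f = f"
  using cmp_ident_left by (auto simp: hom_iff)

lemma cmp_ident [simp]: "arr f \<Longrightarrow> src f = a \<Longrightarrow> f \<cdot> ident C a = f"
  using cmp_ident_right by (auto simp: hom_iff)

lemma assoc_cmp [simp]:
  "arr f \<Longrightarrow> arr g \<Longrightarrow> arr h \<Longrightarrow> trg f = src g \<Longrightarrow> trg g = src h \<Longrightarrow>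
    (h \<cdot> g) \<cdot> f = h \<cdot> (g \<cdot> f)"
  using cmp_assoc by (simp add: hom_iff)

lemma inverse_of_unique:
  assumes g: "inverse_of C a b f g" and h: "inverse_of C a b f h"
  shows "g = h"
proof -
  note typed = g[unfolded inverse_of_def hom_iff] h[unfolded inverse_of_def hom_iff]
  have "g = (h \<cdot> f) \<cdot> g" using typed by auto
  also have "\<dots> = h \<cdot> (f \<cdot> g)" using typed by (intro assoc_cmp) auto
  also have "\<dots> = h" using typed by auto
  finally show ?thesis .
qed

lemma inverse_arrow_inverse_of:
  assumes "iso C a b f"
  shows "inverse_of C a b f (inverse_arrow C a b f)"
  unfolding inverse_arrow_def
  by (rule theI') (use assms inverse_of_unique in \<open>auto simp: iso_def\<close>)

lemma iso_typed:
  assumes "iso C a b f"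
  shows "arr f" "src f = a" "trg f = b" "a \<in> obj C" "b \<in> obj C"
  using assms hom_obj by (auto simp: iso_def inverse_of_def hom_iff)

lemma inverse_arrow_simps [simp]:
  assumes "iso C a b f"
  shows "arr (inverse_arrow C a b f)" "src (inverse_arrow C a b f) = b"
    "trg (inverse_arrow C a b f) = a"
    "f \<cdot> inverse_arrow C a b f = ident C b" "inverse_arrow C a b f \<cdot> f = ident C a"
  using inverse_arrow_inverse_of[OF assms] by (auto simp: inverse_of_def hom_iff)

lemma inverse_arrow_iso: "iso C a b f \<Longrightarrow> iso C b a (inverse_arrow C a b f)"
  using inverse_arrow_inverse_of[of a b f] unfolding iso_def[of C b a] inverse_of_def by blast

lemma inverse_arrow_tail [simp]:
  assumes "iso C a b f" "arr h"
  shows "trg h = b \<Longrightarrow> f \<cdot> inverse_arrow C a b f \<cdot> h = h"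
    and "trg h = a \<Longrightarrow> inverse_arrow C a b f \<cdot> f \<cdot> h = h"
  using assoc_cmp[of h "inverse_arrow C a b f" f] assoc_cmp[of h f "inverse_arrow C a b f"]
    assms iso_typed[OF assms(1)] by simp_all

lemma ident_iso [simp]: "a \<in> obj C \<Longrightarrow> iso C a a (ident C a)"
  unfolding iso_def inverse_of_def
  by (rule exI[of _ "ident C a"]) (simp add: hom_iff)

lemma isoI:
  "arr f \<Longrightarrow> arr g \<Longrightarrow> src f = a \<Longrightarrow> trg f = b \<Longrightarrow> src g = b \<Longrightarrow> trg g = a \<Longrightarrow>
    g \<cdot> f = ident C a \<Longrightarrow> f \<cdot> g = ident C b \<Longrightarrow> iso C a b f"
  unfolding iso_def inverse_of_def by (auto simp: hom_iff)

lemma iso_cmp: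
  assumes f: "iso C a b f" and g: "iso C b c g"
  shows "iso C a c (g \<cdot> f)"
  by (rule isoI[where g = "inverse_arrow C a b f \<cdot> inverse_arrow C b c g"])
    (use f g iso_typed[OF f] iso_typed[OF g] in simp_all)

lemma iso_cancel_left:
  assumes eq: "i \<cdot> f = i \<cdot> g" and i: "iso C b c i"
    and typed: "arr f" "arr g" "trg f = b" "trg g = b"
  shows "f = g"
proof -
  have "f = inverse_arrow C b c i \<cdot> i \<cdot> f" using i typed by simp
  also have "\<dots> = inverse_arrow C b c i \<cdot> i \<cdot> g" by (simp only: eq)
  also have "\<dots> = g" using i typed by simp
  finally show ?thesis .
qed

lemma iso_cancel_right:
  assumes eq: "f \<cdot> i = g \<cdot> i" and i: "iso C a b i"
    and typed: "arr f" "arr g" "src f = b" "src g = b"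
  shows "f = g"
proof -
  have *: "h = (h \<cdot> i) \<cdot> inverse_arrow C a b i" if "arr h" "src h = b" for h
    using that i iso_typed[OF i] by simp
  have "f = (f \<cdot> i) \<cdot> inverse_arrow C a b i" using typed by (intro *)
  also have "\<dots> = (g \<cdot> i) \<cdot> inverse_arrow C a b i" by (simp only: eq)
  also have "\<dots> = g" using typed by (intro *[symmetric])
  finally show ?thesis .
qed

end

section \<open>Unit isomorphisms in a symmetric monoidal category\<close>

context symmetric_monoidal_category begin

declare unit_obj [simp] tens_obj [simp] tens_ident [simp]

lemma tens_typed [simp]:
  assumes "arr f" "arr g"
  shows "arr (f \<otimes> g)" "src (f \<otimes> g) = src f \<oplus> src g" "trg (f \<otimes> g) = trg f \<oplus> trg g"
  using tens_hom[of f "src f" "trg f" g "src g" "trg g"] assms by (simp_all add: hom_iff)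

lemma interchange:
  "arr f \<Longrightarrow> arr g \<Longrightarrow> arr f' \<Longrightarrow> arr g' \<Longrightarrow> trg f = src g \<Longrightarrow> trg f' = src g' \<Longrightarrow>
    (g \<otimes> g') \<cdot> (f \<otimes> f') = (g \<cdot> f) \<otimes> (g' \<cdot> f')"
  using tens_cmp[of f "src f" "trg f" g "trg g" f' "src f'" "trg f'" g' "trg g'"]
  by (simp add: hom_iff)

lemma interchange_tail:
  assumes "arr f" "arr g" "arr f'" "arr g'" "trg f = src g" "trg f' = src g'"
    "arr h" "trg h = src f \<oplus> src f'"
  shows "(g \<otimes> g') \<cdot> (f \<otimes> f') \<cdot> h = ((g \<cdot> f) \<otimes> (g' \<cdot> f')) \<cdot> h"
  using interchange[OF assms(1-6)] assms by (metis assoc_cmp tens_typed)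

lemma iso_tens:
  assumes f: "iso C a b f" and g: "iso C c d g"
  shows "iso C (a \<oplus> c) (b \<oplus> d) (f \<otimes> g)"
proof (rule isoI[where g = "inverse_arrow C a b f \<otimes> inverse_arrow C c d g"])
qed (simp_all add: iso_typed[OF f] iso_typed[OF g] inverse_arrow_simps[OF f]
      inverse_arrow_simps[OF g] interchange)

lemma runit_typed [simp]:
  assumes "a \<in> obj C"
  shows "arr (runit C a)" "src (runit C a) = a \<oplus> \<e>" "trg (runit C a) = a"
  using iso_typed[OF runit_iso[OF assms]] by simp_all

lemma assoc_typed [simp]:
  assumes "a \<in> obj C" "b \<in> obj C" "c \<in> obj C"
  shows "arr (assoc C a b c)" "src (assoc C a b c) = (a \<oplus> b) \<oplus> c"
    "trg (assoc C a b c) = a \<oplus> (b \<oplus> c)"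
  using iso_typed[OF assoc_iso[OF assms]] by simp_all

lemma symm_typed [simp]:
  assumes "a \<in> obj C" "b \<in> obj C"
  shows "arr (symm C a b)" "src (symm C a b) = a \<oplus> b" "trg (symm C a b) = b \<oplus> a"
  using symm_hom[OF assms] by (simp_all add: hom_iff)

lemma symm_iso:
  assumes "a \<in> obj C" "b \<in> obj C"
  shows "iso C (a \<oplus> b) (b \<oplus> a) (symm C a b)"
  by (rule isoI[where g = "symm C b a"]) (simp_all add: assms symm_symm)

lemma runit_nat: "arr f \<Longrightarrow> runit C (trg f) \<cdot> (f \<otimes> ident C \<e>) = f \<cdot> runit C (src f)"
  using runit_natural arr_hom by blast

lemma assoc_nat: "arr f \<Longrightarrow> arr g \<Longrightarrow> arr h \<Longrightarrow>
    assoc C (trg f) (trg g) (trg h) \<cdot> ((f \<otimes> g) \<otimes> h) =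
    (f \<otimes> (g \<otimes> h)) \<cdot> assoc C (src f) (src g) (src h)"
  using assoc_natural arr_hom by blast

lemma symm_nat: "arr f \<Longrightarrow> arr g \<Longrightarrow>
    symm C (trg f) (trg g) \<cdot> (f \<otimes> g) = (g \<otimes> f) \<cdot> symm C (src f) (src g)"
  using symm_natural arr_hom by blast

abbreviation lunit :: "'o \<Rightarrow> 'a" where
  "lunit b \<equiv> runit C b \<cdot> symm C \<e> b"

text \<open>
  The natural isomorphism \<open>runit\<close> identifies the functor \<open>f \<mapsto> f \<otimes> ident C \<e>\<close> with the identity
  functor, so that functor is faithful.
\<close>

lemma tens_unit_cancel:
  assumes "arr f" "arr g" "src f = src g" "trg f = trg g"
    and eq: "f \<otimes> ident C \<e> = g \<otimes> ident C \<e>"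
  shows "f = g"
  by (rule iso_cancel_right[OF _ runit_iso[of "src f"]])
    (use runit_nat[of f] runit_nat[of g] assms in simp_all)

text \<open>
  Both sides may be compared after tensoring with \<open>\<e>\<close>, where the triangle expresses
  \<open>runit C (a \<oplus> b) \<otimes> ident C \<e>\<close> by the left unit isomorphism of \<open>\<e>\<close>, and the pentagon turns this
  into the triangle for \<open>b\<close>. The argument is Kelly's.
\<close>

lemma runit_tens:
  assumes [simp]: "a \<in> obj C" "b \<in> obj C"
  shows "(ident C a \<otimes> runit C b) \<cdot> assoc C a b \<e> = runit C (a \<oplus> b)"
proof -
  have "assoc C a b \<e> \<cdot> (runit C (a \<oplus> b) \<otimes> ident C \<e>) =
      assoc C a b \<e> \<cdot> (ident C (a \<oplus> b) \<otimes> lunit \<e>) \<cdot> assoc C (a \<oplus> b) \<e> \<e>"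
    by (simp add: triangle)
  also have "\<dots> = (assoc C a b \<e> \<cdot> ((ident C a \<otimes> ident C b) \<otimes> lunit \<e>)) \<cdot> assoc C (a \<oplus> b) \<e> \<e>"
    by simp
  also have "\<dots> = ((ident C a \<otimes> (ident C b \<otimes> lunit \<e>)) \<cdot> assoc C a b (\<e> \<oplus> \<e>)) \<cdot> assoc C (a \<oplus> b) \<e> \<e>"
    using assoc_nat[of "ident C a" "ident C b" "lunit \<e>"] by (simp del: tens_ident)
  also have "\<dots> = (ident C a \<otimes> (ident C b \<otimes> lunit \<e>)) \<cdot> (assoc C a b (\<e> \<oplus> \<e>) \<cdot> assoc C (a \<oplus> b) \<e> \<e>)"
    by simp
  also have "\<dots> = (ident C a \<otimes> (ident C b \<otimes> lunit \<e>)) \<cdot> (ident C a \<otimes> assoc C b \<e> \<e>) \<cdot>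
      assoc C a (b \<oplus> \<e>) \<e> \<cdot> (assoc C a b \<e> \<otimes> ident C \<e>)"
    by (simp add: pentagon)
  also have "\<dots> = (ident C a \<otimes> ((ident C b \<otimes> lunit \<e>) \<cdot> assoc C b \<e> \<e>)) \<cdot>
      assoc C a (b \<oplus> \<e>) \<e> \<cdot> (assoc C a b \<e> \<otimes> ident C \<e>)"
    by (simp add: interchange_tail)
  also have "\<dots> = ((ident C a \<otimes> (runit C b \<otimes> ident C \<e>)) \<cdot> assoc C a (b \<oplus> \<e>) \<e>) \<cdot>
      (assoc C a b \<e> \<otimes> ident C \<e>)"
    by (simp add: triangle)
  also have "\<dots> = (assoc C a b \<e> \<cdot> ((ident C a \<otimes> runit C b) \<otimes> ident C \<e>)) \<cdot>
      (assoc C a b \<e> \<otimes> ident C \<e>)"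
    using assoc_nat[of "ident C a" "runit C b" "ident C \<e>"] by simp
  also have "\<dots> = assoc C a b \<e> \<cdot> (((ident C a \<otimes> runit C b) \<cdot> assoc C a b \<e>) \<otimes> ident C \<e>)"
    by (simp add: interchange)
  finally have "runit C (a \<oplus> b) \<otimes> ident C \<e> =
      ((ident C a \<otimes> runit C b) \<cdot> assoc C a b \<e>) \<otimes> ident C \<e>"
    by (rule iso_cancel_left[OF _ assoc_iso[of a b \<e>]]) simp_all
  then show ?thesis
    by (rule tens_unit_cancel[symmetric, rotated -1]) simp_all
qed

lemma runit_unit_tens: "runit C (\<e> \<oplus> \<e>) = runit C \<e> \<otimes> ident C \<e>"
  by (rule iso_cancel_left[OF _ runit_iso[of \<e>]]) (use runit_nat[of "runit C \<e>"] in simp_all)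

text \<open>
  By \<open>runit_tens\<close> and \<open>runit_unit_tens\<close>, \<open>ident C \<e> \<otimes> runit C \<e>\<close> satisfies the equation that the
  triangle imposes on \<open>ident C \<e> \<otimes> lunit \<e>\<close>. The symmetry moves the identity factor to the
  right, where it cancels.
\<close>

lemma lunit_unit: "lunit \<e> = runit C \<e>"
proof -
  have "(ident C \<e> \<otimes> lunit \<e>) \<cdot> assoc C \<e> \<e> \<e> = (ident C \<e> \<otimes> runit C \<e>) \<cdot> assoc C \<e> \<e> \<e>"
    by (simp add: triangle runit_tens runit_unit_tens)
  then have *: "ident C \<e> \<otimes> lunit \<e> = ident C \<e> \<otimes> runit C \<e>"
    by (rule iso_cancel_right[OF _ assoc_iso[of \<e> \<e> \<e>]]) simp_all
  have "(lunit \<e> \<otimes> ident C \<e>) \<cdot> symm C \<e> (\<e> \<oplus> \<e>) = symm C \<e> \<e> \<cdot> (ident C \<e> \<otimes> lunit \<e>)"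
    using symm_nat[of "ident C \<e>" "lunit \<e>"] by simp
  also have "\<dots> = (runit C \<e> \<otimes> ident C \<e>) \<cdot> symm C \<e> (\<e> \<oplus> \<e>)"
    using symm_nat[of "ident C \<e>" "runit C \<e>"] by (simp add: *)
  finally have "lunit \<e> \<otimes> ident C \<e> = runit C \<e> \<otimes> ident C \<e>"
    by (rule iso_cancel_right[OF _ symm_iso[of \<e> "\<e> \<oplus> \<e>"]]) simp_all
  then show ?thesis by (rule tens_unit_cancel[rotated -1]) simp_all
qed

lemma symm_unit: "symm C \<e> \<e> = ident C (\<e> \<oplus> \<e>)"
  by (rule iso_cancel_left[OF _ runit_iso[of \<e>]]) (simp_all add: lunit_unit)

end

context symmetric_monoidal_category begin

section \<open>Canonical arrows\<close>

lemma symm_conj: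
  assumes [simp]: "arr f" "arr g"
  shows "symm C (trg g) (trg f) \<cdot> (g \<otimes> f) \<cdot> symm C (src f) (src g) = f \<otimes> g"
proof -
  have "symm C (trg g) (trg f) \<cdot> (g \<otimes> f) \<cdot> symm C (src f) (src g) =
      (symm C (trg g) (trg f) \<cdot> symm C (trg f) (trg g)) \<cdot> (f \<otimes> g)"
    using symm_nat[of f g] by simp
  also have "\<dots> = f \<otimes> g" by (simp only: symm_symm trg_obj assms) simp
  finally show ?thesis .
qed

text \<open>
  No rule for canonical arrows creates, deletes or duplicates a variable. Hence the intermediate
  words of a derivation have the variables of its end points.
\<close>

lemma canonical_mset_vars: "canonical C u v \<eta> \<Longrightarrow> mset (vars u) = mset (vars v)"
  by (induction rule: canonical.induct) auto

lemma canonical_set_vars: "canonical C u v \<eta> \<Longrightarrow> set (vars u) = set (vars v)"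
  by (metis canonical_mset_vars mset_eq_setD)

lemma canonical_distinct: "canonical C u v \<eta> \<Longrightarrow> distinct (vars u) \<longleftrightarrow> distinct (vars v)"
  by (metis canonical_mset_vars mset_eq_imp_distinct_iff)

lemma eval_obj_in_obj [simp]:
  "set xs \<subseteq> obj C \<Longrightarrow> set (vars w) \<subseteq> {..<length xs} \<Longrightarrow> eval_obj C w xs \<in> obj C"
  by (induction w) auto

lemma eval_obj_local:
  "(\<And>i. i \<in> set (vars w) \<Longrightarrow> xs ! i = ys ! i) \<Longrightarrow> eval_obj C w xs = eval_obj C w ys"
  by (induction w) auto

lemma canonical_arrow_iso:
  assumes "canonical C u v \<eta>" "set xs \<subseteq> obj C" "set (vars u) \<subseteq> {..<length xs}"
  shows "iso C (eval_obj C u xs) (eval_obj C v xs) (\<eta> xs)"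
  using assms
proof (induction rule: canonical.induct)
  case (cmp u v \<eta> w \<theta>)
  then show ?case using canonical_set_vars[OF cmp.hyps(1)] by (simp add: iso_cmp)
next
  case (inverse u v \<eta>)
  then show ?case using canonical_set_vars[OF inverse.hyps] by (simp add: inverse_arrow_iso)
qed (simp_all add: iso_tens runit_iso assoc_iso symm_iso)

section \<open>Canonical arrows at the unit object\<close>

text \<open>
  The canonical arrow to \<open>\<e>\<close> from a word all of whose variables have the value \<open>\<e>\<close>.
\<close>

primrec collapse :: "nat word \<Rightarrow> 'a" where
  "collapse (Var i) = ident C \<e>"
| "collapse E = ident C \<e>"
| "collapse (Plus u w) = runit C \<e> \<cdot> (collapse u \<otimes> collapse w)"

lemma collapse_iso:
  "(\<And>i. i \<in> set (vars w) \<Longrightarrow> xs ! i = \<e>) \<Longrightarrow> iso C (eval_obj C w xs) \<e> (collapse w)"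
  by (induction w) (auto intro!: iso_cmp iso_tens runit_iso)

text \<open>
  For the associator the claim is \<open>runit_tens\<close> at the unit object, and for the symmetry it is
  \<open>symm_unit\<close>. The isomorphism property is part of the induction because it is what allows the
  case of an inverse to be cancelled.
\<close>

lemma collapse_canonical:
  assumes "canonical C u v \<eta>" "\<And>i. i \<in> set (vars u) \<Longrightarrow> xs ! i = \<e>"
  shows "iso C (eval_obj C u xs) (eval_obj C v xs) (\<eta> xs) \<and> collapse v \<cdot> \<eta> xs = collapse u"
  using assms
proof (induction rule: canonical.induct)
  case (ident w)
  then show ?case using collapse_iso[of w xs] by (simp add: iso_typed)
next
  case (cmp u v \<eta> w \<theta>)
  have v: "xs ! i = \<e>" if "i \<in> set (vars v)" for i
    using cmp.prems canonical_set_vars[OF cmp.hyps(1)] that by auto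
  have w: "xs ! i = \<e>" if "i \<in> set (vars w)" for i
    using v canonical_set_vars[OF cmp.hyps(2)] that by auto
  have *: "iso C (eval_obj C u xs) (eval_obj C v xs) (\<eta> xs)" "collapse v \<cdot> \<eta> xs = collapse u"
    "iso C (eval_obj C v xs) (eval_obj C w xs) (\<theta> xs)" "collapse w \<cdot> \<theta> xs = collapse v"
    using cmp.IH(1)[OF cmp.prems] cmp.IH(2)[OF v] by blast+
  have "collapse w \<cdot> \<theta> xs \<cdot> \<eta> xs = (collapse w \<cdot> \<theta> xs) \<cdot> \<eta> xs"
    using *(1,3) collapse_iso[of w xs] w by (simp add: iso_typed)
  then show ?case using * by (auto intro: iso_cmp)
next
  case (tens u u' \<eta> v v' \<theta>)
  have 1: "iso C (eval_obj C u xs) (eval_obj C u' xs) (\<eta> xs) \<and> collapse u' \<cdot> \<eta> xs = collapse u"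
    "iso C (eval_obj C v xs) (eval_obj C v' xs) (\<theta> xs) \<and> collapse v' \<cdot> \<theta> xs = collapse v"
    using tens by auto
  have 2: "iso C (eval_obj C u' xs) \<e> (collapse u')" "iso C (eval_obj C v' xs) \<e> (collapse v')"
    using tens canonical_set_vars by (auto intro!: collapse_iso)
  from 1 2 show ?case by (auto simp: iso_typed interchange intro: iso_tens)
next
  case (inverse u v \<eta>)
  have 1: "iso C (eval_obj C u xs) (eval_obj C v xs) (\<eta> xs)" "collapse v \<cdot> \<eta> xs = collapse u"
    using inverse.IH inverse.prems canonical_set_vars[OF inverse.hyps] by auto
  have 2: "iso C (eval_obj C v xs) \<e> (collapse v)"
    using inverse canonical_set_vars by (auto intro!: collapse_iso)
  let ?i = "inverse_arrow C (eval_obj C u xs) (eval_obj C v xs) (\<eta> xs)"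
  have "collapse u \<cdot> ?i = (collapse v \<cdot> \<eta> xs) \<cdot> ?i" by (simp add: 1)
  also have "\<dots> = collapse v" using 1(1) 2 by (simp add: iso_typed)
  finally show ?case using 1(1) by (simp add: inverse_arrow_iso)
next
  case (runit u)
  then have u: "iso C (eval_obj C u xs) \<e> (collapse u)" by (simp add: collapse_iso)
  from u show ?case using runit_nat[of "collapse u"] by (simp add: iso_typed runit_iso)
next
  case (assoc u v w)
  then have i: "iso C (eval_obj C u xs) \<e> (collapse u)" "iso C (eval_obj C v xs) \<e> (collapse v)"
    "iso C (eval_obj C w xs) \<e> (collapse w)" by (simp_all add: collapse_iso)
  note [simp] = iso_typed[OF i(1)] iso_typed[OF i(2)] iso_typed[OF i(3)]
  let ?a = "assoc C (eval_obj C u xs) (eval_obj C v xs) (eval_obj C w xs)"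
  have split: "x \<otimes> (r \<cdot> y) = (ident C \<e> \<otimes> r) \<cdot> (x \<otimes> y)" "(r \<cdot> y) \<otimes> x = (r \<otimes> ident C \<e>) \<cdot> (y \<otimes> x)"
    if "arr x" "arr y" "arr r" "trg y = src r" "trg x = \<e>" for x y r
    using that by (simp_all add: interchange)
  have "collapse (Plus u (Plus v w)) \<cdot> ?a =
      runit C \<e> \<cdot> (ident C \<e> \<otimes> runit C \<e>) \<cdot> ((collapse u \<otimes> collapse v \<otimes> collapse w) \<cdot> ?a)"
    by (simp add: split)
  also have "\<dots> = runit C \<e> \<cdot> ((ident C \<e> \<otimes> runit C \<e>) \<cdot> assoc C \<e> \<e> \<e>) \<cdot>
      ((collapse u \<otimes> collapse v) \<otimes> collapse w)"
    using assoc_nat[of "collapse u" "collapse v" "collapse w"] by simp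
  also have "\<dots> = collapse (Plus (Plus u v) w)"
    by (simp add: runit_tens runit_unit_tens split)
  finally show ?case by (simp add: assoc_iso)
next
  case (symm u v)
  then have i: "iso C (eval_obj C u xs) \<e> (collapse u)" "iso C (eval_obj C v xs) \<e> (collapse v)"
    by (simp_all add: collapse_iso)
  note [simp] = iso_typed[OF i(1)] iso_typed[OF i(2)]
  show ?case
    using symm_nat[of "collapse u" "collapse v"] by (simp add: symm_unit symm_iso)
qed

lemma canonical_unique_at_unit:
  assumes "canonical C u v \<eta>" "canonical C u v \<theta>" "\<And>i. i \<in> set (vars u) \<Longrightarrow> xs ! i = \<e>"
  shows "\<eta> xs = \<theta> xs"
proof (rule iso_cancel_left)
  show "iso C (eval_obj C v xs) \<e> (collapse v)"
    using assms canonical_set_vars by (auto intro!: collapse_iso)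
  show "collapse v \<cdot> \<eta> xs = collapse v \<cdot> \<theta> xs"
    using collapse_canonical[OF assms(1,3)] collapse_canonical[OF assms(2,3)] by simp
qed (use collapse_canonical[OF assms(1,3)] collapse_canonical[OF assms(2,3)] in
    \<open>auto simp: iso_typed\<close>)

section \<open>Moving a variable to the front\<close>

text \<open>
  Coherence fails for words with repeated variables: the symmetry of \<open>x\<^sub>1 \<oplus> x\<^sub>1\<close> need not be the
  identity. By \<open>canonical_mset_vars\<close>, multilinearity passes along canonical arrows.
\<close>

definition multilinear :: "nat \<Rightarrow> nat word \<Rightarrow> bool" where
  "multilinear n w \<longleftrightarrow> distinct (vars w) \<and> set (vars w) \<subseteq> {..<n}"

lemma multilinear_Plus [simp]:
  "multilinear n (Plus u w) \<longleftrightarrow> multilinear n u \<and> multilinear n w \<and> set (vars u) \<inter> set (vars w) = {}"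
  by (auto simp: multilinear_def)

lemma multilinear_E [simp]: "multilinear n E"
  by (simp add: multilinear_def)

context
  fixes i :: nat and xs :: "'o list"
  assumes xs_obj: "set xs \<subseteq> obj C" and i_less: "i < length xs"
begin

private abbreviation "x \<equiv> xs ! i"
private abbreviation "xs' \<equiv> xs[i := \<e>]"
private abbreviation ev where "ev w \<equiv> eval_obj C w xs"
private abbreviation ev' where "ev' w \<equiv> eval_obj C w xs'"

private abbreviation "linear \<equiv> multilinear (length xs)"

text \<open>
  For a multilinear word \<open>w\<close> containing the variable \<open>i\<close>, \<open>front w\<close> goes from \<open>w\<close> at \<open>xs\<close> to
  \<open>x \<oplus> w\<close>, where the second \<open>w\<close> is evaluated at \<open>xs'\<close>. So the variable is not removed from the
  word but replaced by the unit, and no words other than \<open>w\<close> come up. If \<open>i\<close> occurs in the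
  second summand, \<open>front\<close> is transported along the symmetry from the word with exchanged
  summands. The value at \<open>E\<close> is a dummy.
\<close>

primrec front :: "nat word \<Rightarrow> 'a" where
  "front (Var j) = inverse_arrow C (x \<oplus> \<e>) x (runit C x)"
| "front E = ident C \<e>"
| "front (Plus u w) =
    (if i \<in> set (vars u)
     then assoc C x (ev' u) (ev w) \<cdot> (front u \<otimes> ident C (ev w))
     else (ident C x \<otimes> symm C (ev' w) (ev u)) \<cdot> assoc C x (ev' w) (ev u) \<cdot>
       (front w \<otimes> ident C (ev u)) \<cdot> symm C (ev u) (ev w))"

lemma x_obj [simp]: "x \<in> obj C"
  using xs_obj i_less by auto

lemma ev_obj [simp]: "linear w \<Longrightarrow> ev w \<in> obj C" "linear w \<Longrightarrow> ev' w \<in> obj C"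
  using xs_obj i_less
  by (auto simp: multilinear_def intro!: eval_obj_in_obj dest!: set_update_subset_insert[THEN
      subsetD])

lemma ev_unchanged: "i \<notin> set (vars w) \<Longrightarrow> ev' w = ev w"
  by (rule eval_obj_local) (metis nth_list_update_neq)

lemma front_iso:
  "linear w \<Longrightarrow> i \<in> set (vars w) \<Longrightarrow> iso C (ev w) (x \<oplus> ev' w) (front w)"
proof (induction w)
  case (Var j)
  then have "j = i" by simp
  then show ?case using i_less inverse_arrow_iso[OF runit_iso[OF x_obj]] by simp
next
  case (Plus u w)
  show ?case
  proof (cases "i \<in> set (vars u)")
    case True
    with Plus have "i \<notin> set (vars w)" by auto
    with Plus True show ?thesis
      by (auto simp: ev_unchanged intro!: iso_cmp[OF _ assoc_iso] iso_tens)
  next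
    case False
    with Plus show ?thesis
      by (auto simp: ev_unchanged
          intro!: iso_cmp[OF _ iso_tens] iso_cmp[OF _ assoc_iso] iso_cmp[OF symm_iso] iso_tens
              symm_iso)
  qed
qed simp_all

text \<open>
  The pair \<open>(f, g)\<close> stands for the components at \<open>xs\<close> and at \<open>xs'\<close> of a canonical family from
  \<open>u\<close> to \<open>v\<close>. If the variable \<open>i\<close> is absent, the two tuples agree on the words, and the
  condition becomes \<open>f = g\<close>; with this case included, the relation is closed under \<open>\<otimes>\<close> no matter
  which factor contains the variable.
\<close>

definition slides :: "nat word \<Rightarrow> nat word \<Rightarrow> 'a \<Rightarrow> 'a \<Rightarrow> bool" where
  "slides u v f g \<longleftrightarrow> iso C (ev u) (ev v) f \<and> iso C (ev' u) (ev' v) g \<and>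
    (if i \<in> set (vars u) then (ident C x \<otimes> g) \<cdot> front u = front v \<cdot> f else f = g)"

lemma slides_cmp:
  assumes f: "slides u v f g" and f': "slides v w f' g'"
    and lin: "linear u" "linear v" "linear w"
    and sets: "set (vars u) = set (vars v)" "set (vars v) = set (vars w)"
  shows "slides u w (f' \<cdot> f) (g' \<cdot> g)"
proof -
  have isos: "iso C (ev u) (ev v) f" "iso C (ev v) (ev w) f'"
     "iso C (ev' u) (ev' v) g" "iso C (ev' v) (ev' w) g'"
    using f f' by (auto simp: slides_def)
  note [simp] = iso_typed[OF isos(1)] iso_typed[OF isos(2)] iso_typed[OF isos(3)] iso_typed[OF
      isos(4)]
  have "(ident C x \<otimes> (g' \<cdot> g)) \<cdot> front u = front w \<cdot> (f' \<cdot> f)" if i: "i \<in> set (vars u)"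
  proof -
    note F = front_iso[OF lin(1) i] front_iso[OF lin(2) i[unfolded sets(1)]] front_iso[OF lin(3)
        i[unfolded sets]]
    note [simp] = iso_typed[OF F(1)] iso_typed[OF F(2)] iso_typed[OF F(3)]
    have "(ident C x \<otimes> (g' \<cdot> g)) \<cdot> front u = (ident C x \<otimes> g') \<cdot> ((ident C x \<otimes> g) \<cdot> front u)"
      by (simp add: interchange_tail)
    also have "\<dots> = (ident C x \<otimes> g') \<cdot> (front v \<cdot> f)"
      using f i by (simp add: slides_def)
    also have "\<dots> = ((ident C x \<otimes> g') \<cdot> front v) \<cdot> f" by simp
    also have "\<dots> = (front w \<cdot> f') \<cdot> f"
      using f' i sets by (simp add: slides_def)
    finally show ?thesis by simp
  qed
  with isos f f' sets show ?thesis by (auto simp: slides_def intro: iso_cmp)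
qed

lemma slides_inverse:
  assumes f: "slides u v f g" and lin: "linear u" "linear v" and sets: "set (vars u) = set (vars v)"
  shows "slides v u (inverse_arrow C (ev u) (ev v) f) (inverse_arrow C (ev' u) (ev' v) g)"
proof -
  have isos: "iso C (ev u) (ev v) f" "iso C (ev' u) (ev' v) g"
    using f by (auto simp: slides_def)
  note [simp] = iso_typed[OF isos(1)] iso_typed[OF isos(2)]
    inverse_arrow_simps[OF isos(1)] inverse_arrow_simps[OF isos(2)] isos
  let ?f = "inverse_arrow C (ev u) (ev v) f" and ?g = "inverse_arrow C (ev' u) (ev' v) g"
  have "(ident C x \<otimes> ?g) \<cdot> front v = front u \<cdot> ?f" if i: "i \<in> set (vars u)"
  proof -
    note F = front_iso[OF lin(1) i] front_iso[OF lin(2) i[unfolded sets(1)]]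
    note [simp] = iso_typed[OF F(1)] iso_typed[OF F(2)]
    have "(ident C x \<otimes> ?g) \<cdot> front v = (ident C x \<otimes> ?g) \<cdot> (front v \<cdot> f) \<cdot> ?f"
      by simp
    also have "\<dots> = (ident C x \<otimes> ?g) \<cdot> ((ident C x \<otimes> g) \<cdot> front u) \<cdot> ?f"
      using f i by (simp add: slides_def)
    also have "\<dots> = front u \<cdot> ?f" by (simp add: interchange_tail)
    finally show ?thesis .
  qed
  moreover have "?f = ?g" if "i \<notin> set (vars u)"
    using f that sets ev_unchanged[of u] ev_unchanged[of v] by (simp add: slides_def)
  ultimately show ?thesis using isos sets by (auto simp: slides_def inverse_arrow_iso)
qed

text \<open>
  By the definition of \<open>front\<close> on a sum whose second summand contains the variable, this is one
  of the two statements that the symmetry slides; the other follows as the symmetries in both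
  directions are mutually inverse.
\<close>

lemma slides_symm:
  assumes lin: "linear (Plus u w)"
  shows "slides (Plus u w) (Plus w u) (symm C (ev u) (ev w)) (symm C (ev' u) (ev' w))"
proof (cases "i \<in> set (vars u)")
  case True
  then have w: "i \<notin> set (vars w)" using lin by auto
  have F: "iso C (ev u) (x \<oplus> ev' u) (front u)" using True lin by (simp add: front_iso)
  note [simp] = iso_typed[OF F]
  from lin True w show ?thesis
    by (simp add: slides_def symm_iso ev_unchanged symm_symm)
next
  case u: False
  show ?thesis
  proof (cases "i \<in> set (vars w)")
    case True
    have F: "iso C (ev w) (x \<oplus> ev' w) (front w)" using True lin by (simp add: front_iso)
    note [simp] = iso_typed[OF F]
    from lin True u show ?thesis
      by (simp add: slides_def symm_iso ev_unchanged interchange_tail symm_symm)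
  next
    case False
    with lin u show ?thesis by (simp add: slides_def symm_iso ev_unchanged)
  qed
qed

lemma slides_tens_left:
  assumes f: "slides u u' f g" and h: "iso C (ev w) (ev w') h"
    and lin: "linear (Plus u w)" "linear (Plus u' w')"
    and sets: "set (vars u) = set (vars u')" "set (vars w) = set (vars w')"
    and i: "i \<in> set (vars u)"
  shows "slides (Plus u w) (Plus u' w') (f \<otimes> h) (g \<otimes> h)"
proof -
  have isos: "iso C (ev u) (ev u') f" "iso C (ev' u) (ev' u') g"
    and eq: "(ident C x \<otimes> g) \<cdot> front u = front u' \<cdot> f"
    using f i by (auto simp: slides_def)
  have w: "i \<notin> set (vars w)" "i \<notin> set (vars w')" using i lin sets by auto
  have F: "iso C (ev u) (x \<oplus> ev' u) (front u)" "iso C (ev u') (x \<oplus> ev' u') (front u')"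
    using lin i sets by (simp_all add: front_iso)
  note [simp] = iso_typed[OF isos(1)] iso_typed[OF isos(2)] iso_typed[OF h] iso_typed[OF F(1)]
      iso_typed[OF F(2)]
  have "(ident C x \<otimes> (g \<otimes> h)) \<cdot> front (Plus u w) =
      ((ident C x \<otimes> (g \<otimes> h)) \<cdot> assoc C x (ev' u) (ev w)) \<cdot> (front u \<otimes> ident C (ev w))"
    using i by simp
  also have "\<dots> = (assoc C x (ev' u') (ev w') \<cdot> ((ident C x \<otimes> g) \<otimes> h)) \<cdot> (front u \<otimes> ident C (ev w))"
    using assoc_nat[of "ident C x" g h] by simp
  also have "\<dots> = assoc C x (ev' u') (ev w') \<cdot> ((front u' \<cdot> f) \<otimes> h)"
    by (simp add: interchange eq)
  also have "\<dots> = front (Plus u' w') \<cdot> (f \<otimes> h)"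
    using i sets by (simp add: interchange)
  finally show ?thesis
    using i w isos h by (simp add: slides_def iso_tens ev_unchanged)
qed

text \<open>
  A variable in the right factor is brought to the left by conjugating with the symmetry, which
  slides itself.
\<close>

lemma slides_tens:
  assumes f: "slides u u' f g" and h: "slides w w' h k"
    and lin: "linear (Plus u w)" "linear (Plus u' w')"
    and sets: "set (vars u) = set (vars u')" "set (vars w) = set (vars w')"
  shows "slides (Plus u w) (Plus u' w') (f \<otimes> h) (g \<otimes> k)"
proof -
  have isos: "iso C (ev u) (ev u') f" "iso C (ev' u) (ev' u') g"
    "iso C (ev w) (ev w') h" "iso C (ev' w) (ev' w') k"
    using f h by (auto simp: slides_def)
  note [simp] = iso_typed[OF isos(1)] iso_typed[OF isos(2)] iso_typed[OF isos(3)] iso_typed[OF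
      isos(4)]
  consider (left) "i \<in> set (vars u)" "i \<notin> set (vars w)" | (right) "i \<notin> set (vars u)" "i \<in> set
      (vars w)"
    | (none) "i \<notin> set (vars u)" "i \<notin> set (vars w)" using lin by auto
  then show ?thesis
  proof cases
    case left
    with h have "h = k" by (simp add: slides_def)
    with left slides_tens_left[OF f isos(3) lin sets] show ?thesis by simp
  next
    case right
    with f have [simp]: "f = g" by (simp add: slides_def)
    have lin': "linear (Plus w u)" "linear (Plus w' u')" using lin by auto
    have unchanged: "ev' u = ev u" "ev' u' = ev u'" using right sets by (auto intro!: ev_unchanged)
    have "slides (Plus w u) (Plus w' u') (h \<otimes> f) (k \<otimes> f)"
      using slides_tens_left[OF h isos(1) lin' sets(2,1)] right by simp
    then have "slides (Plus u w) (Plus u' w')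
       (symm C (ev w') (ev u') \<cdot> (h \<otimes> f) \<cdot> symm C (ev u) (ev w))
       (symm C (ev' w') (ev' u') \<cdot> (k \<otimes> f) \<cdot> symm C (ev' u) (ev' w))"
      by (intro slides_cmp[OF slides_cmp[OF slides_symm _] slides_symm])
        (use lin lin' sets in auto)
    moreover have "symm C (ev w') (ev u') \<cdot> (h \<otimes> f) \<cdot> symm C (ev u) (ev w) = f \<otimes> h"
      using symm_conj[of f h] by (simp add: unchanged)
    moreover have "symm C (ev' w') (ev' u') \<cdot> (k \<otimes> f) \<cdot> symm C (ev' u) (ev' w) = g \<otimes> k"
      using symm_conj[of f k] by (simp add: unchanged)
    ultimately show ?thesis by simp
  next
    case none
    with f h isos show ?thesis by (simp add: slides_def iso_tens)
  qed
qed

lemma slides_runit: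
  assumes lin: "linear u"
  shows "slides (Plus u E) u (runit C (ev u)) (runit C (ev' u))"
proof (cases "i \<in> set (vars u)")
  case True
  have F: "iso C (ev u) (x \<oplus> ev' u) (front u)" using True lin by (simp add: front_iso)
  note [simp] = iso_typed[OF F]
  have "(ident C x \<otimes> runit C (ev' u)) \<cdot> front (Plus u E) =
     ((ident C x \<otimes> runit C (ev' u)) \<cdot> assoc C x (ev' u) \<e>) \<cdot> (front u \<otimes> ident C \<e>)"
    using True lin by simp
  also have "\<dots> = front u \<cdot> runit C (ev u)"
    using lin runit_nat[of "front u"] by (simp add: runit_tens)
  finally show ?thesis using lin True by (simp add: slides_def runit_iso)
next
  case False
  with lin show ?thesis by (simp add: slides_def runit_iso ev_unchanged)
qed

lemma slides_ident: "linear u \<Longrightarrow> slides u u (ident C (ev u)) (ident C (ev' u))"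
proof (cases "i \<in> set (vars u)")
  case True
  assume lin: "linear u"
  have F: "iso C (ev u) (x \<oplus> ev' u) (front u)" using True lin by (simp add: front_iso)
  with lin True show ?thesis by (simp add: slides_def iso_typed[OF F])
qed (simp add: slides_def ev_unchanged)

text \<open>
  The next two lemmas serve to solve the hexagon for one of its associators.
\<close>

lemma slides_cancel_left:
  assumes k: "slides v w k k'" and kf: "slides u w (k \<cdot> f) (k' \<cdot> f')"
    and f: "iso C (ev u) (ev v) f" "iso C (ev' u) (ev' v) f'"
    and lin: "linear u" "linear v" "linear w"
    and sets: "set (vars u) = set (vars v)" "set (vars v) = set (vars w)"
  shows "slides u v f f'"
proof -
  have isos: "iso C (ev v) (ev w) k" "iso C (ev' v) (ev' w) k'"
    using k by (auto simp: slides_def)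
  have "inverse_arrow C (ev v) (ev w) k \<cdot> k \<cdot> f = f"
    "inverse_arrow C (ev' v) (ev' w) k' \<cdot> k' \<cdot> f' = f'"
    using isos iso_typed[OF f(1)] iso_typed[OF f(2)] by simp_all
  with slides_cmp[OF kf slides_inverse[OF k lin(2,3) sets(2)] lin(1,3,2)
      trans[OF sets] sets(2)[symmetric]]
  show ?thesis by simp
qed

lemma slides_cancel_right:
  assumes k: "slides u v k k'" and fk: "slides u w (f \<cdot> k) (f' \<cdot> k')"
    and f: "iso C (ev v) (ev w) f" "iso C (ev' v) (ev' w) f'"
    and lin: "linear u" "linear v" "linear w"
    and sets: "set (vars u) = set (vars v)" "set (vars v) = set (vars w)"
  shows "slides v w f f'"
proof -
  have isos: "iso C (ev u) (ev v) k" "iso C (ev' u) (ev' v) k'"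
    using k by (auto simp: slides_def)
  have "(f \<cdot> k) \<cdot> inverse_arrow C (ev u) (ev v) k = f"
    "(f' \<cdot> k') \<cdot> inverse_arrow C (ev' u) (ev' v) k' = f'"
    using isos iso_typed[OF f(1)] iso_typed[OF f(2)] iso_typed[OF isos(1)] iso_typed[OF isos(2)]
    by simp_all
  with slides_cmp[OF slides_inverse[OF k lin(1,2) sets(1)] fk lin(2,1,3)
      sets(1)[symmetric] trans[OF sets]]
  show ?thesis by (simp del: assoc_cmp)
qed

text \<open>
  Up to the naturality of the associator this is the pentagon for \<open>x\<close>, \<open>u'\<close>, \<open>v\<close>, \<open>w\<close>.
\<close>

lemma slides_assoc_first:
  assumes lin: "linear (Plus (Plus u v) w)" and i: "i \<in> set (vars u)"
  shows "slides (Plus (Plus u v) w) (Plus u (Plus v w))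
    (assoc C (ev u) (ev v) (ev w)) (assoc C (ev' u) (ev' v) (ev' w))"
proof -
  have F: "iso C (ev u) (x \<oplus> ev' u) (front u)" using i lin by (simp add: front_iso)
  note [simp] = iso_typed[OF F]
  have un: "ev' v = ev v" "ev' w = ev w" using i lin by (auto intro!: ev_unchanged)
  have [simp]: "ev u \<in> obj C" "ev' u \<in> obj C" "ev v \<in> obj C" "ev w \<in> obj C" using lin by auto
  let ?F = "(front u \<otimes> ident C (ev v)) \<otimes> ident C (ev w)"
  have "(ident C x \<otimes> assoc C (ev' u) (ev' v) (ev' w)) \<cdot> front (Plus (Plus u v) w) =
    (ident C x \<otimes> assoc C (ev' u) (ev v) (ev w)) \<cdot> assoc C x (ev' u \<oplus> ev v) (ev w) \<cdot>
       ((assoc C x (ev' u) (ev v) \<cdot> (front u \<otimes> ident C (ev v))) \<otimes> ident C (ev w))"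
    using i by (simp add: un)
  also have "\<dots> = ((ident C x \<otimes> assoc C (ev' u) (ev v) (ev w)) \<cdot> assoc C x (ev' u \<oplus> ev v) (ev w) \<cdot>
       (assoc C x (ev' u) (ev v) \<otimes> ident C (ev w))) \<cdot> ?F"
    by (simp add: interchange)
  also have "\<dots> = (assoc C x (ev' u) (ev v \<oplus> ev w) \<cdot> assoc C (x \<oplus> ev' u) (ev v) (ev w)) \<cdot> ?F"
    by (simp only: pentagon x_obj \<open>ev' u \<in> obj C\<close> \<open>ev v \<in> obj C\<close> \<open>ev w \<in> obj C\<close>)
  also have "\<dots> = assoc C x (ev' u) (ev v \<oplus> ev w) \<cdot> (assoc C (x \<oplus> ev' u) (ev v) (ev w) \<cdot> ?F)"
    by simp
  also have "\<dots> = assoc C x (ev' u) (ev v \<oplus> ev w) \<cdot>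
      (front u \<otimes> (ident C (ev v) \<otimes> ident C (ev w))) \<cdot> assoc C (ev u) (ev v) (ev w)"
    using assoc_nat[of "front u" "ident C (ev v)" "ident C (ev w)"] by (simp del: tens_ident)
  also have "\<dots> = front (Plus u (Plus v w)) \<cdot> assoc C (ev u) (ev v) (ev w)"
    using i by simp
  finally show ?thesis using i by (simp add: slides_def assoc_iso un)
qed

text \<open>
  The hexagon for \<open>u\<close>, \<open>v\<close>, \<open>w\<close> expresses their associator by symmetries and the associators of
  \<open>v, u, w\<close> and \<open>v, w, u\<close>, in which the word \<open>v\<close> containing the variable comes first.
\<close>

lemma slides_assoc_second:
  assumes lin: "linear (Plus (Plus u v) w)" and i: "i \<in> set (vars v)"
  shows "slides (Plus (Plus u v) w) (Plus u (Plus v w))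
    (assoc C (ev u) (ev v) (ev w)) (assoc C (ev' u) (ev' v) (ev' w))"
proof -
  let ?k = "\<lambda>ev. assoc C (ev v) (ev w) (ev u) \<cdot> symm C (ev u) (ev v \<oplus> ev w)"
  have [simp]: "ev u \<in> obj C" "ev' u \<in> obj C" "ev v \<in> obj C" "ev' v \<in> obj C"
    "ev w \<in> obj C" "ev' w \<in> obj C" using lin by auto
  have k: "slides (Plus u (Plus v w)) (Plus v (Plus w u)) (?k ev) (?k ev')"
    using slides_cmp[OF slides_symm[of u "Plus v w"] slides_assoc_first[of v w u]] lin i
    by (simp add: Un_ac Int_ac Int_Un_distrib)
  have "slides (Plus (Plus u v) w) (Plus v (Plus w u))
     ((ident C (ev v) \<otimes> symm C (ev u) (ev w)) \<cdot> assoc C (ev v) (ev u) (ev w) \<cdot>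
       (symm C (ev u) (ev v) \<otimes> ident C (ev w)))
     ((ident C (ev' v) \<otimes> symm C (ev' u) (ev' w)) \<cdot> assoc C (ev' v) (ev' u) (ev' w) \<cdot>
       (symm C (ev' u) (ev' v) \<otimes> ident C (ev' w)))"
    by (intro slides_cmp[OF slides_cmp[OF slides_tens[OF slides_symm slides_ident]
            slides_assoc_first] slides_tens[OF slides_ident slides_symm]])
      (use lin i in auto)
  then have "slides (Plus (Plus u v) w) (Plus v (Plus w u))
     (?k ev \<cdot> assoc C (ev u) (ev v) (ev w)) (?k ev' \<cdot> assoc C (ev' u) (ev' v) (ev' w))"
    by (simp add: hexagon)
  from slides_cancel_left[OF k this] lin show ?thesis by (auto simp: assoc_iso)
qed

text \<open>
  In the hexagon for \<open>w\<close>, \<open>u\<close>, \<open>v\<close> the other two associators are those of \<open>w, u, v\<close> and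
  \<open>u, w, v\<close>, where the word \<open>w\<close> containing the variable comes first and second.
\<close>

lemma slides_assoc_third:
  assumes lin: "linear (Plus (Plus u v) w)" and i: "i \<in> set (vars w)"
  shows "slides (Plus (Plus u v) w) (Plus u (Plus v w))
    (assoc C (ev u) (ev v) (ev w)) (assoc C (ev' u) (ev' v) (ev' w))"
proof -
  let ?k = "\<lambda>ev. symm C (ev w) (ev u \<oplus> ev v) \<cdot> assoc C (ev w) (ev u) (ev v)"
  have [simp]: "ev u \<in> obj C" "ev' u \<in> obj C" "ev v \<in> obj C" "ev' v \<in> obj C"
    "ev w \<in> obj C" "ev' w \<in> obj C" using lin by auto
  have k: "slides (Plus (Plus w u) v) (Plus (Plus u v) w) (?k ev) (?k ev')"
    using slides_cmp[OF slides_assoc_first[of w u v] slides_symm[of w "Plus u v"]] lin i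
    by (simp add: Un_ac Int_ac Int_Un_distrib)
  have "slides (Plus (Plus w u) v) (Plus u (Plus v w))
     ((ident C (ev u) \<otimes> symm C (ev w) (ev v)) \<cdot> assoc C (ev u) (ev w) (ev v) \<cdot>
       (symm C (ev w) (ev u) \<otimes> ident C (ev v)))
     ((ident C (ev' u) \<otimes> symm C (ev' w) (ev' v)) \<cdot> assoc C (ev' u) (ev' w) (ev' v) \<cdot>
       (symm C (ev' w) (ev' u) \<otimes> ident C (ev' v)))"
    by (intro slides_cmp[OF slides_cmp[OF slides_tens[OF slides_symm slides_ident]
            slides_assoc_second] slides_tens[OF slides_ident slides_symm]])
      (use lin i in auto)
  then have "slides (Plus (Plus w u) v) (Plus u (Plus v w))
     (assoc C (ev u) (ev v) (ev w) \<cdot> ?k ev) (assoc C (ev' u) (ev' v) (ev' w) \<cdot> ?k ev')"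
    by (simp add: hexagon)
  from slides_cancel_right[OF k this] lin show ?thesis by (auto simp: assoc_iso)
qed

lemma canonical_linear: "canonical C u v \<eta> \<Longrightarrow> linear u \<longleftrightarrow> linear v"
  using canonical_distinct[of u v \<eta>] canonical_set_vars[of u v \<eta>] by (simp add: multilinear_def)

lemma slides_canonical:
  "canonical C u v \<eta> \<Longrightarrow> linear u \<Longrightarrow> slides u v (\<eta> xs) (\<eta> xs')"
proof (induction rule: canonical.induct)
  case (cmp u v \<eta> w \<theta>)
  have "linear v" "linear w"
    using cmp.prems cmp.hyps canonical_linear by blast+
  then show ?case
    using cmp.IH cmp.prems canonical_set_vars[OF cmp.hyps(1)] canonical_set_vars[OF cmp.hyps(2)]
    by (intro slides_cmp[of u v _ _ w]) auto
next
  case (tens u u' \<eta> v v' \<theta>)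
  have "linear u'" "linear v'"
    using tens.prems tens.hyps canonical_linear by auto
  then show ?case
    using tens.IH tens.prems canonical_set_vars[OF tens.hyps(1)] canonical_set_vars[OF tens.hyps(2)]
    by (intro slides_tens) auto
next
  case (inverse u v \<eta>)
  have "linear u"
    using inverse.prems inverse.hyps canonical_linear by blast
  then show ?case
    using inverse.IH inverse.prems canonical_set_vars[OF inverse.hyps]
    by (intro slides_inverse) auto
next
  case (assoc u v w)
  consider "i \<in> set (vars u)" | "i \<in> set (vars v)" | "i \<in> set (vars w)"
    | "i \<notin> set (vars (Plus (Plus u v) w))" by auto
  then show ?case
  proof cases
    case 4
    with assoc show ?thesis by (simp add: slides_def ev_unchanged assoc_iso)
  qed (use assoc slides_assoc_first slides_assoc_second slides_assoc_third in auto)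
qed (simp_all add: slides_ident slides_runit slides_symm)

text \<open>
  As \<open>front v\<close> is invertible, a canonical family at \<open>xs\<close> can be recovered from its value at
  \<open>xs'\<close>.
\<close>

lemma canonical_unique_step:
  assumes "canonical C u v \<eta>" "canonical C u v \<theta>" and lin: "linear u" and eq: "\<eta> xs' = \<theta> xs'"
  shows "\<eta> xs = \<theta> xs"
proof -
  have s: "slides u v (\<eta> xs) (\<eta> xs')" "slides u v (\<theta> xs) (\<theta> xs')"
    using slides_canonical[OF assms(1) lin] slides_canonical[OF assms(2) lin] by simp_all
  show ?thesis
  proof (cases "i \<in> set (vars u)")
    case True
    have "linear v" "i \<in> set (vars v)"
      using lin True canonical_linear[OF assms(1)] canonical_set_vars[OF assms(1)] by auto
    then have F: "iso C (ev v) (x \<oplus> ev' v) (front v)" by (rule front_iso)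
    have isos: "iso C (ev u) (ev v) (\<eta> xs)" "iso C (ev u) (ev v) (\<theta> xs)"
      using s by (auto simp: slides_def)
    have "front v \<cdot> \<eta> xs = front v \<cdot> \<theta> xs"
      using s True eq by (simp add: slides_def)
    then show ?thesis
      by (rule iso_cancel_left[OF _ F]) (use isos in \<open>simp_all add: iso_typed\<close>)
  next
    case False
    with s eq show ?thesis by (simp add: slides_def)
  qed
qed

end

text \<open>
  Uniqueness in Mac Lane's theorem. The induction is on the number \<open>k\<close> of leading entries of the
  tuple that may still differ from \<open>\<e>\<close>.
\<close>

theorem canonical_unique:
  assumes can: "canonical C u v \<eta>" "canonical C u v \<theta>"
    and dist: "distinct (vars u)" and xs: "set (vars u) \<subseteq> {..<length xs}" "set xs \<subseteq> obj C"
  shows "\<eta> xs = \<theta> xs"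
proof -
  have "\<eta> ys = \<theta> ys"
    if "set ys \<subseteq> obj C" "length ys = length xs" "k \<le> length xs" "\<forall>i<length xs. k \<le> i \<longrightarrow> ys ! i = \<e>"
        for ys k
    using that
  proof (induction k arbitrary: ys)
    case 0
    then show ?case using xs by (intro canonical_unique_at_unit[OF can]) auto
  next
    case (Suc k)
    have "\<eta> (ys[k := \<e>]) = \<theta> (ys[k := \<e>])"
    proof (rule Suc.IH)
      show "set (ys[k := \<e>]) \<subseteq> obj C"
        using Suc.prems set_update_subset_insert[of ys k \<e>] by auto
    qed (use Suc.prems in \<open>auto simp: nth_list_update\<close>)
    then show ?case
      by (rule canonical_unique_step[where xs = ys and i = k, OF _ _ can, rotated -1])
        (use Suc.prems dist xs in \<open>simp_all add: multilinear_def\<close>)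
  qed
  from this[of xs "length xs"] xs show ?thesis by simp
qed

end

context symmetric_monoidal_category begin

section \<open>Existence of canonical arrows\<close>

lemma canonical_exists_Plus:
  "(\<exists>\<eta>. canonical C u u' \<eta>) \<Longrightarrow> (\<exists>\<eta>. canonical C v v' \<eta>) \<Longrightarrow> \<exists>\<eta>. canonical C (Plus u v) (Plus u' v') \<eta>"
  by (blast intro: canonical.tens)

lemma canonical_exists_trans:
  "(\<exists>\<eta>. canonical C u v \<eta>) \<Longrightarrow> (\<exists>\<eta>. canonical C v w \<eta>) \<Longrightarrow> \<exists>\<eta>. canonical C u w \<eta>"
  by (blast intro: canonical.cmp)

text \<open>
  Ending every normal form in \<open>E\<close> makes the empty list and the singletons regular cases.
\<close>

definition normal_form :: "nat list \<Rightarrow> nat word" where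
  "normal_form l = foldr (\<lambda>v. Plus (Var v)) l E"

lemma normal_form_simps [simp]:
  "normal_form [] = E" "normal_form (v # l) = Plus (Var v) (normal_form l)"
  by (simp_all add: normal_form_def)

lemma normal_form_append:
  "\<exists>\<eta>. canonical C (Plus (normal_form l) (normal_form l')) (normal_form (l @ l')) \<eta>"
proof (induction l)
  case Nil
  have "\<exists>\<eta>. canonical C (Plus E (normal_form l')) (Plus (normal_form l') E) \<eta>"
    by (blast intro: canonical.symm)
  then show ?case
    by (auto intro: canonical_exists_trans canonical.runit)
next
  case (Cons v l)
  have "\<exists>\<eta>. canonical C (Plus (normal_form (v # l)) (normal_form l'))
      (Plus (Var v) (Plus (normal_form l) (normal_form l'))) \<eta>"
    by (auto intro: canonical.assoc)
  moreover have "\<exists>\<eta>. canonical C (Plus (Var v) (Plus (normal_form l) (normal_form l')))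
      (Plus (Var v) (normal_form (l @ l'))) \<eta>"
    using Cons by (blast intro: canonical_exists_Plus canonical.ident)
  ultimately show ?case by (auto intro: canonical_exists_trans)
qed

lemma canonical_to_normal_form: "\<exists>\<eta>. canonical C w (normal_form (vars w)) \<eta>"
proof (induction w)
  case (Plus u w)
  show ?case
    using canonical_exists_trans[OF canonical_exists_Plus[OF Plus] normal_form_append] by simp
qed (auto intro: canonical.ident canonical.inverse[OF canonical.runit])

text \<open>
  The head of the first list is moved past the part of the second list that precedes it, and the
  induction hypothesis rearranges the rest.
\<close>

lemma canonical_between_normal_forms:
  "mset l = mset l' \<Longrightarrow> \<exists>\<eta>. canonical C (normal_form l) (normal_form l') \<eta>"
proof (induction l arbitrary: l')
  case Nil
  then show ?case by (auto intro: canonical.ident)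
next
  case (Cons v l)
  then have "v \<in> set l'" by (metis list.set_intros(1) mset_eq_setD)
  then obtain p q where l': "l' = p @ v # q" by (meson split_list)
  let ?V = "Var v" and ?p = "normal_form p" and ?q = "normal_form q"
  have swap: "\<exists>\<eta>. canonical C (Plus ?V (Plus ?p ?q)) (Plus ?p (Plus ?V ?q)) \<eta>"
    by (rule canonical_exists_trans[of _ "Plus (Plus ?V ?p) ?q"],
        blast intro: canonical.inverse[OF canonical.assoc],
        rule canonical_exists_trans[of _ "Plus (Plus ?p ?V) ?q"])
      (blast intro: canonical.assoc canonical_exists_Plus canonical.symm canonical.ident)+
  have "\<exists>\<eta>. canonical C (normal_form l) (normal_form (p @ q)) \<eta>"
    using Cons by (simp add: l')
  then have "\<exists>\<eta>. canonical C (normal_form l) (Plus ?p ?q) \<eta>"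
    using normal_form_append[of p q] by (blast intro: canonical.inverse canonical.cmp)
  then have "\<exists>\<eta>. canonical C (normal_form (v # l)) (Plus ?V (Plus ?p ?q)) \<eta>"
    by (auto intro: canonical_exists_Plus canonical.ident)
  from canonical_exists_trans[OF canonical_exists_trans[OF this swap]]
  show ?case using normal_form_append[of p "v # q"] by (simp add: l')
qed

theorem canonical_exists:
  assumes "mset (vars u) = mset (vars v)"
  shows "\<exists>\<eta>. canonical C u v \<eta>"
  using canonical_to_normal_form[of u] canonical_to_normal_form[of v]
    canonical_between_normal_forms[OF assms]
  by (blast intro: canonical.inverse canonical.cmp)

section \<open>Naturality of canonical arrows\<close>

lemma eval_arr_typed [simp]:
  assumes "set (vars w) \<subseteq> {..<length fs}" "\<forall>f \<in> set fs. arr f"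
  shows "arr (eval_arr C w fs)" "src (eval_arr C w fs) = eval_obj C w (map src fs)"
    "trg (eval_arr C w fs) = eval_obj C w (map trg fs)"
  using assms by (induction w) auto

lemma eval_arr_cmp:
  assumes "set (vars w) \<subseteq> {..<length fs}" "\<forall>f \<in> set fs. arr f" "\<forall>g \<in> set gs. arr g"
    "map trg fs = map src gs"
  shows "eval_arr C w (map2 (\<cdot>) gs fs) = eval_arr C w gs \<cdot> eval_arr C w fs"
  using assms(1)
proof (induction w)
  case (Var i)
  then show ?case using map_eq_imp_length_eq[OF assms(4)] by simp
next
  case (Plus u w)
  have "length fs = length gs" using assms(4) by (rule map_eq_imp_length_eq)
  with Plus assms(2-4) show ?case by (simp add: interchange)
qed simp

lemma canonical_natural:
  assumes "canonical C u v \<eta>" "set (vars u) \<subseteq> {..<length fs}" "\<forall>f \<in> set fs. arr f"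
  shows "eval_arr C v fs \<cdot> \<eta> (map src fs) = \<eta> (map trg fs) \<cdot> eval_arr C u fs"
proof -
  have objs: "set (map src fs) \<subseteq> obj C" "set (map trg fs) \<subseteq> obj C" using assms(3) by auto
  have isos: "iso C (eval_obj C u (map src fs)) (eval_obj C v (map src fs)) (\<eta> (map src fs))"
    "iso C (eval_obj C u (map trg fs)) (eval_obj C v (map trg fs)) (\<eta> (map trg fs))"
    if "canonical C u v \<eta>" "set (vars u) \<subseteq> {..<length fs}" for u v \<eta>
    using canonical_arrow_iso[OF that(1)] objs that(2) by simp_all
  show ?thesis
    using assms(1,2)
  proof (induction rule: canonical.induct)
    case (ident w)
    then show ?case using assms(3) objs by simp
  next
    case (cmp u v \<eta> w \<theta>)
    have v: "set (vars v) \<subseteq> {..<length fs}" and w: "set (vars w) \<subseteq> {..<length fs}"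
      using cmp.prems canonical_set_vars[OF cmp.hyps(1)] canonical_set_vars[OF cmp.hyps(2)] by auto
    note i = isos[OF cmp.hyps(1) cmp.prems] isos[OF cmp.hyps(2) v]
    note [simp] = iso_typed[OF i(1)] iso_typed[OF i(2)] iso_typed[OF i(3)] iso_typed[OF i(4)]
    have "eval_arr C w fs \<cdot> \<theta> (map src fs) \<cdot> \<eta> (map src fs) =
        (eval_arr C w fs \<cdot> \<theta> (map src fs)) \<cdot> \<eta> (map src fs)"
      using assms(3) w by simp
    also have "\<dots> = \<theta> (map trg fs) \<cdot> (eval_arr C v fs \<cdot> \<eta> (map src fs))"
      using assms(3) v by (simp add: cmp.IH(2)[OF v])
    also have "\<dots> = (\<theta> (map trg fs) \<cdot> \<eta> (map trg fs)) \<cdot> eval_arr C u fs"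
      using assms(3) cmp.prems by (simp add: cmp.IH(1)[OF cmp.prems])
    finally show ?case .
  next
    case (tens u u' \<eta> v v' \<theta>)
    have sub: "set (vars u) \<subseteq> {..<length fs}" "set (vars v) \<subseteq> {..<length fs}"
      "set (vars u') \<subseteq> {..<length fs}" "set (vars v') \<subseteq> {..<length fs}"
      using tens.prems canonical_set_vars[OF tens.hyps(1)] canonical_set_vars[OF tens.hyps(2)] by
          auto
    note i = isos[OF tens.hyps(1) sub(1)] isos[OF tens.hyps(2) sub(2)]
    note [simp] = iso_typed[OF i(1)] iso_typed[OF i(2)] iso_typed[OF i(3)] iso_typed[OF i(4)]
    show ?case
      using assms(3) sub by (simp add: interchange tens.IH)
  next
    case (inverse u v \<eta>)
    have sub: "set (vars u) \<subseteq> {..<length fs}" "set (vars v) \<subseteq> {..<length fs}"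
      using inverse.prems canonical_set_vars[OF inverse.hyps] by auto
    note i = isos[OF inverse.hyps sub(1)]
    note [simp] = i iso_typed[OF i(1)] iso_typed[OF i(2)]
    let ?s = "inverse_arrow C (eval_obj C u (map src fs)) (eval_obj C v (map src fs)) (\<eta> (map src
        fs))"
    let ?t = "inverse_arrow C (eval_obj C u (map trg fs)) (eval_obj C v (map trg fs)) (\<eta> (map trg
        fs))"
    have "eval_arr C u fs \<cdot> ?s = ?t \<cdot> (\<eta> (map trg fs) \<cdot> eval_arr C u fs) \<cdot> ?s"
      using assms(3) sub by simp
    also have "\<dots> = ?t \<cdot> (eval_arr C v fs \<cdot> \<eta> (map src fs)) \<cdot> ?s"
      by (simp only: inverse.IH[OF sub(1)])
    also have "\<dots> = ?t \<cdot> eval_arr C v fs"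
      using assms(3) sub by simp
    finally show ?case .
  next
    case (runit u)
    then show ?case using assms(3) runit_nat[of "eval_arr C u fs"] by simp
  next
    case (assoc u v w)
    then show ?case
      using assms(3) assoc_nat[of "eval_arr C u fs" "eval_arr C v fs" "eval_arr C w fs"] by simp
  next
    case (symm u v)
    then show ?case
      using assms(3) symm_nat[of "eval_arr C u fs" "eval_arr C v fs"] by simp
  qed
qed

section \<open>Substitution in canonical arrows\<close>

lemma eval_obj_subst:
  "set (vars w) \<subseteq> {..<n} \<Longrightarrow>
    eval_obj C (subst \<rho> w) xs = eval_obj C w (map (\<lambda>s. eval_obj C (\<rho> s) xs) [0..<n])"
  by (induction w) auto

text \<open>
  Substituting words for the variables of a derivation gives a derivation. Its components are
  those of the given family at the tuple of values of the substituted words. The list runs over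
  \<open>[0..<n]\<close> because families are indexed by tuples, so all variables must lie below \<open>n\<close>.
\<close>

lemma canonical_subst:
  assumes "canonical C u v \<eta>" "set (vars u) \<subseteq> {..<n}"
  shows "canonical C (subst \<rho> u) (subst \<rho> v) (\<lambda>xs. \<eta> (map (\<lambda>s. eval_obj C (\<rho> s) xs) [0..<n]))"
  using assms
proof (induction rule: canonical.induct)
  case (ident w)
  then show ?case using canonical.ident[of C "subst \<rho> w"] by (simp add: eval_obj_subst[where n = n])
next
  case (cmp u v \<eta> w \<theta>)
  then show ?case using canonical_set_vars[OF cmp.hyps(1)] by (simp add: canonical.cmp)
next
  case (tens u u' \<eta> v v' \<theta>)
  then show ?case by (simp add: canonical.tens)
next
  case (inverse u v \<eta>)
  then have "set (vars v) \<subseteq> {..<n}" "set (vars u) \<subseteq> {..<n}"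
    using canonical_set_vars[OF inverse.hyps] by simp_all
  with canonical.inverse[OF inverse.IH] show ?case
    by (simp add: eval_obj_subst[where n = n])
next
  case (runit u)
  then show ?case using canonical.runit[of C "subst \<rho> u"] by (simp add: eval_obj_subst[where n = n])
next
  case (assoc u v w)
  then show ?case
    using canonical.assoc[of C "subst \<rho> u" "subst \<rho> v" "subst \<rho> w"] by (simp add:
        eval_obj_subst[where n = n])
next
  case (symm u v)
  then show ?case
    using canonical.symm[of C "subst \<rho> u" "subst \<rho> v"] by (simp add: eval_obj_subst[where n = n])
qed

lemma canonical_subst_inner:
  assumes "\<And>s. s \<in> set (vars w) \<Longrightarrow> canonical C (\<rho> s) (\<rho>' s) (\<theta> s)" "set (vars w) \<subseteq> {..<n}"
  shows "canonical C (subst \<rho> w) (subst \<rho>' w) (\<lambda>xs. eval_arr C w (map (\<lambda>s. \<theta> s xs) [0..<n]))"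
  using assms
proof (induction w)
  case E
  show ?case using canonical.ident[of C E] by simp
next
  case (Plus u w)
  then show ?case by (simp add: canonical.tens)
qed simp

section \<open>Calculus of coherence isomorphisms\<close>

text \<open>
  Coherence provides exactly one canonical arrow between two such words at each \<open>n\<close>-tuple of
  objects. Not all variables below \<open>n\<close> need to occur: renaming the variables of a word so that
  it fits into one slot of a composite gives a word in a block of the variables only.
\<close>

definition parallel :: "nat \<Rightarrow> nat word \<Rightarrow> nat word \<Rightarrow> bool" where
  "parallel n u v \<longleftrightarrow> distinct (vars u) \<and> distinct (vars v) \<and> set (vars u) = set (vars v) \<and>
     set (vars u) \<subseteq> {..<n}"

lemma parallel_vars:
  assumes "parallel n u v"
  shows "set (vars u) \<subseteq> {..<n}" "set (vars v) \<subseteq> {..<n}"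
  using assms by (auto simp: parallel_def)

abbreviation coh :: "nat word \<Rightarrow> nat word \<Rightarrow> 'o list \<Rightarrow> 'a" where
  "coh \<equiv> canonical_iso C"

text \<open>
  From here on, equations between coherence isomorphisms are obtained by exhibiting one
  derivation.
\<close>

lemma coh_eqI:
  assumes "canonical C u v \<eta>" "parallel (length xs) u v" "set xs \<subseteq> obj C"
  shows "coh u v xs = \<eta> xs"
  unfolding canonical_iso_def
proof (rule the_equality)
  show "f = \<eta> xs" if "\<exists>\<eta>. canonical C u v \<eta> \<and> f = \<eta> xs" for f
    using that canonical_unique[OF _ assms(1)] assms(2,3) by (auto simp: parallel_def)
qed (use assms(1) in auto)

lemma coh_canonical:
  assumes "parallel n u v"
  obtains \<eta> where "canonical C u v \<eta>"
    "\<And>xs. length xs = n \<Longrightarrow> set xs \<subseteq> obj C \<Longrightarrow> coh u v xs = \<eta> xs"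
proof -
  have "mset (vars u) = mset (vars v)"
    using assms set_eq_iff_mset_eq_distinct[of "vars u" "vars v"] by (auto simp: parallel_def)
  then obtain \<eta> where "canonical C u v \<eta>" using canonical_exists by blast
  with coh_eqI that assms show thesis by blast
qed

lemma coh_iso:
  assumes "parallel (length xs) u v" "set xs \<subseteq> obj C"
  shows "iso C (eval_obj C u xs) (eval_obj C v xs) (coh u v xs)"
  using coh_canonical[OF assms(1)] canonical_arrow_iso[of u v _ xs] assms
  by (metis parallel_def)

lemma coh_typed [simp]:
  assumes "parallel (length xs) u v" "set xs \<subseteq> obj C"
  shows "arr (coh u v xs)" "src (coh u v xs) = eval_obj C u xs" "trg (coh u v xs) = eval_obj C v xs"
  using iso_typed[OF coh_iso[OF assms]] by simp_all

lemma coh_refl: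
  assumes "parallel (length xs) u u" "set xs \<subseteq> obj C"
  shows "coh u u xs = ident C (eval_obj C u xs)"
  by (rule coh_eqI[OF canonical.ident assms])

lemma parallel_trans: "parallel n u v \<Longrightarrow> parallel n v w \<Longrightarrow> parallel n u w"
  by (auto simp: parallel_def)

lemma coh_trans:
  assumes p: "parallel (length xs) u v" "parallel (length xs) v w" and xs: "set xs \<subseteq> obj C"
  shows "coh v w xs \<cdot> coh u v xs = coh u w xs"
proof -
  obtain \<eta> where \<eta>: "canonical C u v \<eta>" "coh u v xs = \<eta> xs"
    using coh_canonical[OF p(1)] xs by metis
  obtain \<theta> where \<theta>: "canonical C v w \<theta>" "coh v w xs = \<theta> xs"
    using coh_canonical[OF p(2)] xs by metis
  show ?thesis
    using coh_eqI[OF canonical.cmp[OF \<eta>(1) \<theta>(1)] parallel_trans[OF p] xs] \<eta>(2) \<theta>(2) by simp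
qed

lemma coh_natural:
  assumes p: "parallel (length fs) u v" and fs: "\<forall>f \<in> set fs. arr f"
  shows "eval_arr C v fs \<cdot> coh u v (map src fs) = coh u v (map trg fs) \<cdot> eval_arr C u fs"
proof -
  obtain \<eta> where \<eta>: "canonical C u v \<eta>"
    "\<And>xs. length xs = length fs \<Longrightarrow> set xs \<subseteq> obj C \<Longrightarrow> coh u v xs = \<eta> xs"
    using coh_canonical[OF p] by metis
  have "coh u v (map src fs) = \<eta> (map src fs)" "coh u v (map trg fs) = \<eta> (map trg fs)"
    using fs by (auto intro!: \<eta>(2))
  then show ?thesis using canonical_natural[OF \<eta>(1) parallel_vars(1)[OF p] fs] by simp
qed

lemma coh_subst:
  assumes p: "parallel n u v" "parallel (length xs) (subst \<rho> u) (subst \<rho> v)"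
    and \<rho>: "\<And>s. s < n \<Longrightarrow> set (vars (\<rho> s)) \<subseteq> {..<length xs}" and xs: "set xs \<subseteq> obj C"
  shows "coh u v (map (\<lambda>s. eval_obj C (\<rho> s) xs) [0..<n]) = coh (subst \<rho> u) (subst \<rho> v) xs"
proof -
  obtain \<eta> where \<eta>: "canonical C u v \<eta>"
    "\<And>ys. length ys = n \<Longrightarrow> set ys \<subseteq> obj C \<Longrightarrow> coh u v ys = \<eta> ys"
    using coh_canonical[OF p(1)] by metis
  have "set (map (\<lambda>s. eval_obj C (\<rho> s) xs) [0..<n]) \<subseteq> obj C"
    using \<rho> xs by auto
  then have "coh u v (map (\<lambda>s. eval_obj C (\<rho> s) xs) [0..<n]) =
      \<eta> (map (\<lambda>s. eval_obj C (\<rho> s) xs) [0..<n])"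
    by (intro \<eta>(2)) auto
  also have "\<dots> = coh (subst \<rho> u) (subst \<rho> v) xs"
    using coh_eqI[OF canonical_subst[OF \<eta>(1) parallel_vars(1)[OF p(1)]] p(2) xs] by simp
  finally show ?thesis .
qed

lemma coh_subst_inner:
  assumes p: "\<And>s. s < n \<Longrightarrow> parallel (length xs) (\<rho> s) (\<rho>' s)"
    "parallel (length xs) (subst \<rho> w) (subst \<rho>' w)"
    and w: "set (vars w) \<subseteq> {..<n}" and xs: "set xs \<subseteq> obj C"
  shows "eval_arr C w (map (\<lambda>s. coh (\<rho> s) (\<rho>' s) xs) [0..<n]) = coh (subst \<rho> w) (subst \<rho>' w) xs"
proof -
  have "\<exists>\<eta>. canonical C (\<rho> s) (\<rho>' s) \<eta> \<and> coh (\<rho> s) (\<rho>' s) xs = \<eta> xs" if "s < n" for s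
    using coh_canonical[OF p(1)[OF that]] xs by metis
  then obtain \<theta> where \<theta>: "\<And>s. s < n \<Longrightarrow> canonical C (\<rho> s) (\<rho>' s) (\<theta> s)"
    "\<And>s. s < n \<Longrightarrow> coh (\<rho> s) (\<rho>' s) xs = \<theta> s xs" by metis
  have "canonical C (subst \<rho> w) (subst \<rho>' w) (\<lambda>xs. eval_arr C w (map (\<lambda>s. \<theta> s xs) [0..<n]))"
    using \<theta>(1) w by (intro canonical_subst_inner) auto
  from coh_eqI[OF this p(2) xs]
  have "coh (subst \<rho> w) (subst \<rho>' w) xs = eval_arr C w (map (\<lambda>s. \<theta> s xs) [0..<n])" .
  also have "map (\<lambda>s. \<theta> s xs) [0..<n] = map (\<lambda>s. coh (\<rho> s) (\<rho>' s) xs) [0..<n]"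
    using \<theta>(2) by simp
  finally show ?thesis by simp
qed

end

section \<open>Positions in concatenated tuples\<close>

lemma offset_Suc: "s < length js \<Longrightarrow> offset js (Suc s) = offset js s + js ! s"
  by (simp add: offset_def take_Suc_conv_app_nth)

lemma offset_mono: "s \<le> t \<Longrightarrow> offset js s \<le> offset js t"
  by (metis offset_def le_Suc_ex take_add sum_list_append le_add1)

lemma offset_length: "offset js (length js) = sum_list js"
  by (simp add: offset_def)

lemma offset_less:
  assumes "s < length js" "i < js ! s"
  shows "offset js s + i < sum_list js"
proof -
  have "offset js s + i < offset js (Suc s)" using assms by (simp add: offset_Suc)
  also have "\<dots> \<le> sum_list js"
    using offset_mono[of "Suc s" "length js" js] assms by (simp add: offset_length)
  finally show ?thesis .
qed

lemma offset_cases: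
  assumes "p < sum_list js"
  obtains s i where "s < length js" "i < js ! s" "p = offset js s + i"
proof -
  have "\<exists>s i. s < length js \<and> i < js ! s \<and> p = offset js s + i"
    using assms
  proof (induction js rule: rev_induct)
    case (snoc j js)
    show ?case
    proof (cases "p < sum_list js")
      case True
      with snoc obtain s i where "s < length js" "i < js ! s" "p = offset js s + i" by blast
      then show ?thesis by (intro exI[of _ s] exI[of _ i]) (simp add: nth_append offset_def)
    next
      case False
      with snoc.prems show ?thesis
        by (intro exI[of _ "length js"] exI[of _ "p - sum_list js"]) (simp add: offset_def)
    qed
  qed simp
  with that show thesis by blast
qed

lemma nth_concat_offset:
  "s < length xss \<Longrightarrow> i < length (xss ! s) \<Longrightarrow>
    concat xss ! (offset (map length xss) s + i) = xss ! s ! i"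
proof (induction xss arbitrary: s)
  case (Cons xs xss)
  then show ?case by (cases s) (auto simp: offset_def nth_append)
qed simp

text \<open>
  This is what makes operadic composition of words associative: the start of a block inside a
  concatenation of concatenations can be counted in one step or in two.
\<close>

lemma offset_concat:
  assumes "s < length jss" "i \<le> length (jss ! s)"
  shows "offset (concat jss) (offset (map length jss) s + i) =
    offset (map sum_list jss) s + offset (jss ! s) i"
  using assms
proof (induction jss arbitrary: s)
  case (Cons js jss)
  then show ?case by (cases s) (auto simp: offset_def)
qed simp

section \<open>Block permutations and sums of permutations\<close>

text \<open>
  The arguments of \<open>block_perm\<close> are positions in the permuted concatenation, whose blocks have
  lengths \<open>permute_list \<sigma> js\<close>; its values are positions in the original one.
\<close>

lemma block_perm_offset:
  assumes \<sigma>: "\<sigma> permutes {..<length js}" and s: "s < length js" and i: "i < js ! \<sigma> s"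
  shows "block_perm \<sigma> js (offset (permute_list \<sigma> js) s + i) = offset js (\<sigma> s) + i"
proof -
  let ?b = "map (\<lambda>s. map (\<lambda>r. offset js (\<sigma> s) + r) [0..<js ! \<sigma> s]) [0..<length js]"
  have lens: "map length ?b = permute_list \<sigma> js"
    by (simp add: permute_list_def)
  have "sum_list (permute_list \<sigma> js) = sum_list js"
    using \<sigma> by (metis mset_permute_list sum_mset_sum_list)
  then have "offset (permute_list \<sigma> js) s + i < sum_list js"
    using offset_less[of s "permute_list \<sigma> js" i] s i \<sigma> by (simp add: permute_list_nth)
  then have "block_perm \<sigma> js (offset (permute_list \<sigma> js) s + i) =
      concat ?b ! (offset (map length ?b) s + i)"
    unfolding lens by (simp add: block_perm_def)
  also have "\<dots> = ?b ! s ! i"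
    using s i by (intro nth_concat_offset) simp_all
  also have "\<dots> = offset js (\<sigma> s) + i" using s i by simp
  finally show ?thesis .
qed

lemma sum_perm_offset:
  assumes s: "s < length js" and i: "i < js ! s"
  shows "sum_perm \<tau>s js (offset js s + i) = offset js s + (\<tau>s ! s) i"
proof -
  let ?b = "map (\<lambda>s. map (\<lambda>r. offset js s + (\<tau>s ! s) r) [0..<js ! s]) [0..<length js]"
  have lens: "map length ?b = js"
    by (rule nth_equalityI) simp_all
  have "offset js s + i < sum_list js" using s i by (rule offset_less)
  then have "sum_perm \<tau>s js (offset js s + i) = concat ?b ! (offset (map length ?b) s + i)"
    unfolding lens by (simp add: sum_perm_def)
  also have "\<dots> = ?b ! s ! i"
    using s i by (intro nth_concat_offset) simp_all
  also have "\<dots> = offset js s + (\<tau>s ! s) i" using s i by simp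
  finally show ?thesis .
qed

text \<open>
  On a finite set it suffices to be onto, and preimages are easier to exhibit than injectivity
  is to check on block positions.
\<close>

lemma permutes_lessThanI:
  assumes fixed: "\<And>p. \<not> p < n \<Longrightarrow> f p = p" and hit: "\<And>q. q < n \<Longrightarrow> \<exists>p<n. f p = q"
  shows "f permutes {..<n::nat}"
proof (rule bij_imp_permutes)
  have sub: "{..<n} \<subseteq> f ` {..<n}" using hit by blast
  then have "card (f ` {..<n}) = n"
    using card_mono[OF _ sub] card_image_le[of "{..<n}" f] by simp
  with sub have "f ` {..<n} = {..<n}"
    by (metis card_lessThan card_subset_eq finite_imageI finite_lessThan)
  then show "bij_betw f {..<n} {..<n}"
    by (simp add: bij_betw_def eq_card_imp_inj_on)
qed (use fixed in auto)

lemma block_perm_permutes: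
  assumes \<sigma>: "\<sigma> permutes {..<length js}"
  shows "block_perm \<sigma> js permutes {..<sum_list js}"
proof (rule permutes_lessThanI)
  fix q assume "q < sum_list js"
  then obtain s i where q: "s < length js" "i < js ! s" "q = offset js s + i"
    by (rule offset_cases)
  define t where "t = inv \<sigma> s"
  have t: "t < length js" "\<sigma> t = s"
    using \<sigma> q permutes_in_image[OF permutes_inv[OF \<sigma>], of s]
    by (auto simp: t_def permutes_inverses)
  have "sum_list (permute_list \<sigma> js) = sum_list js"
    using \<sigma> by (metis mset_permute_list sum_mset_sum_list)
  then have "offset (permute_list \<sigma> js) t + i < sum_list js"
    using offset_less[of t "permute_list \<sigma> js" i] t q \<sigma> by (simp add: permute_list_nth)
  moreover have "block_perm \<sigma> js (offset (permute_list \<sigma> js) t + i) = q"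
    using block_perm_offset[OF \<sigma> t(1)] t q by simp
  ultimately show "\<exists>p<sum_list js. block_perm \<sigma> js p = q" by blast
qed (simp add: block_perm_def)

lemma sum_perm_permutes:
  assumes \<tau>s: "\<And>s. s < length js \<Longrightarrow> \<tau>s ! s permutes {..<js ! s}"
  shows "sum_perm \<tau>s js permutes {..<sum_list js}"
proof (rule permutes_lessThanI)
  fix q assume "q < sum_list js"
  then obtain s i where q: "s < length js" "i < js ! s" "q = offset js s + i"
    by (rule offset_cases)
  define j where "j = inv (\<tau>s ! s) i"
  have j: "j < js ! s" "(\<tau>s ! s) j = i"
    using \<tau>s[OF q(1)] q permutes_in_image[OF permutes_inv[OF \<tau>s[OF q(1)]], of i]
    by (auto simp: j_def permutes_inverses)
  have "offset js s + j < sum_list js" using q(1) j(1) by (rule offset_less)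
  moreover have "sum_perm \<tau>s js (offset js s + j) = q"
    using sum_perm_offset[OF q(1) j(1)] j q by simp
  ultimately show "\<exists>p<sum_list js. sum_perm \<tau>s js p = q" by blast
qed (simp add: sum_perm_def)

lemma permute_list_concat:
  assumes \<sigma>: "\<sigma> permutes {..<length xss}"
  shows "permute_list (block_perm \<sigma> (map length xss)) (concat xss) = concat (permute_list \<sigma> xss)"
proof (rule nth_equalityI)
  let ?js = "map length xss"
  have \<sigma>': "\<sigma> permutes {..<length ?js}" using \<sigma> by simp
  have lens: "map length (permute_list \<sigma> xss) = permute_list \<sigma> ?js"
    using \<sigma> by (simp add: permute_list_map)
  have sums: "sum_list (permute_list \<sigma> ?js) = sum_list ?js"
    using \<sigma>' by (metis mset_permute_list sum_mset_sum_list)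
  show "length (permute_list (block_perm \<sigma> ?js) (concat xss)) = length (concat (permute_list \<sigma>
      xss))"
    by (simp add: length_concat lens sums)
  fix p assume "p < length (permute_list (block_perm \<sigma> ?js) (concat xss))"
  then have p: "p < sum_list ?js" by (simp add: length_concat)
  with sums have "p < sum_list (permute_list \<sigma> ?js)" by simp
  then obtain s i where s: "s < length (permute_list \<sigma> ?js)" "i < permute_list \<sigma> ?js ! s"
    and peq: "p = offset (permute_list \<sigma> ?js) s + i" by (rule offset_cases)
  have \<sigma>s: "\<sigma> s < length xss" using s permutes_in_image[OF \<sigma>, of s] by simp
  then have i: "i < length (xss ! \<sigma> s)" using s \<sigma>' by (simp add: permute_list_nth)
  have "permute_list (block_perm \<sigma> ?js) (concat xss) ! p = concat xss ! (offset ?js (\<sigma> s) + i)"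
    using p block_perm_permutes[OF \<sigma>'] block_perm_offset[OF \<sigma>', of s i] s i \<sigma>s
    by (simp add: permute_list_nth length_concat peq)
  also have "\<dots> = permute_list \<sigma> xss ! s ! i"
    using \<sigma>s i s \<sigma> by (simp add: nth_concat_offset permute_list_nth)
  also have "\<dots> = concat (permute_list \<sigma> xss) ! (offset (map length (permute_list \<sigma> xss)) s + i)"
    using \<sigma>s i s \<sigma> by (intro nth_concat_offset[symmetric]) (simp_all add: permute_list_nth)
  finally show "permute_list (block_perm \<sigma> ?js) (concat xss) ! p = concat (permute_list \<sigma> xss) ! p"
    by (simp add: peq lens)
qed

lemma concat_permute_list:
  assumes len: "length \<tau>s = length xss"
    and \<tau>s: "\<And>s. s < length xss \<Longrightarrow> \<tau>s ! s permutes {..<length (xss ! s)}"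
  shows "permute_list (sum_perm \<tau>s (map length xss)) (concat xss) =
    concat (map2 permute_list \<tau>s xss)"
proof (rule nth_equalityI)
  let ?js = "map length xss"
  have lens: "map length (map2 permute_list \<tau>s xss) = ?js"
    using len by (intro nth_equalityI) simp_all
  have perm: "sum_perm \<tau>s ?js permutes {..<sum_list ?js}"
    using \<tau>s by (intro sum_perm_permutes) simp
  show "length (permute_list (sum_perm \<tau>s ?js) (concat xss)) =
      length (concat (map2 permute_list \<tau>s xss))"
    unfolding length_permute_list length_concat lens ..
  fix p assume "p < length (permute_list (sum_perm \<tau>s ?js) (concat xss))"
  then have p: "p < sum_list ?js" by (simp add: length_concat)
  then obtain s i where "s < length ?js" "i < ?js ! s" and peq: "p = offset ?js s + i"
    by (rule offset_cases)
  then have s: "s < length xss" "i < length (xss ! s)" by simp_all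
  have \<tau>i: "(\<tau>s ! s) i < length (xss ! s)" using permutes_in_image[OF \<tau>s[OF s(1)], of i] s by simp
  have "permute_list (sum_perm \<tau>s ?js) (concat xss) ! p = concat xss ! (offset ?js s + (\<tau>s ! s) i)"
    using p perm s by (simp add: permute_list_nth length_concat peq sum_perm_offset)
  also have "\<dots> = map2 permute_list \<tau>s xss ! s ! i"
    using s \<tau>i \<tau>s[OF s(1)] len by (simp add: nth_concat_offset permute_list_nth)
  also have "\<dots> = concat (map2 permute_list \<tau>s xss) ! (offset (map length (map2 permute_list \<tau>s
      xss)) s + i)"
    using s len by (intro nth_concat_offset[symmetric]) simp_all
  finally show "permute_list (sum_perm \<tau>s ?js) (concat xss) ! p = concat (map2 permute_list \<tau>s
      xss) ! p"
    unfolding lens peq .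
qed

section \<open>The operad of words\<close>

lemma vars_map_word [simp]: "vars (map_word f w) = map f (vars w)"
  by (induction w) auto

lemma vars_subst: "vars (subst \<rho> w) = concat (map (\<lambda>s. vars (\<rho> s)) (vars w))"
  by (induction w) auto

lemma map_word_as_subst: "map_word f w = subst (\<lambda>i. Var (f i)) w"
  by (induction w) auto

lemma subst_Var [simp]: "subst Var w = w"
  by (induction w) auto

lemma subst_subst: "subst \<rho> (subst \<rho>' w) = subst (\<lambda>i. subst \<rho> (\<rho>' i)) w"
  by (induction w) auto

lemma subst_cong:
  "(\<And>i. i \<in> set (vars w) \<Longrightarrow> \<rho> i = \<rho>' i) \<Longrightarrow> subst \<rho> w = subst \<rho>' w"
  by (induction w) auto

lemma subst_map_word: "subst \<rho> (map_word f w) = subst (\<lambda>i. \<rho> (f i)) w"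
  by (induction w) auto

lemma map_word_subst: "map_word f (subst \<rho> w) = subst (\<lambda>i. map_word f (\<rho> i)) w"
  by (induction w) auto

lemma map_word_comp: "map_word f (map_word g w) = map_word (\<lambda>i. f (g i)) w"
  by (induction w) auto

lemma map_word_cong_vars:
  "(\<And>i. i \<in> set (vars w) \<Longrightarrow> f i = g i) \<Longrightarrow> map_word f w = map_word g w"
  by (induction w) auto

lemma Y_arity: "w \<in> Y n \<Longrightarrow> arity w = n"
  unfolding Y_def arity_def by (metis (mono_tags) card_lessThan distinct_card mem_Collect_eq)

lemma Y_vars: "w \<in> Y n \<Longrightarrow> i \<in> set (vars w) \<longleftrightarrow> i < n"
  by (auto simp: Y_def)

lemma operad_act_in_Y:
  assumes "w \<in> Y n" "\<sigma> permutes {..<n}"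
  shows "operad_act w \<sigma> \<in> Y n"
proof -
  have "inv \<sigma> permutes {..<n}" by (rule permutes_inv[OF assms(2)])
  with assms(1) show ?thesis
    by (auto simp: Y_def operad_act_def distinct_map permutes_image intro: permutes_inj_on)
qed

lemma arity_operad_comp:
  assumes "w \<in> Y (length us)"
  shows "arity (operad_comp w us) = sum_list (map arity us)"
proof -
  have "arity (operad_comp w us) = sum_list (map (\<lambda>s. arity (us ! s)) (vars w))"
    unfolding operad_comp_def arity_def vars_subst length_concat map_map by (simp add: comp_def)
  also have "\<dots> = (\<Sum>s<length us. arity (us ! s))"
    using assms by (simp add: Y_def sum_list_distinct_conv_sum_set)
  also have "\<dots> = sum_list (map arity us)"
    by (simp add: sum_list_sum_nth atLeast0LessThan)
  finally show ?thesis .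
qed

text \<open>
  The variables of the composite fill all positions below the sum of the arities, and there are
  as many of them as positions, so none is repeated.
\<close>

lemma operad_comp_in_Y:
  assumes w: "w \<in> Y (length us)" and us: "\<And>s. s < length us \<Longrightarrow> us ! s \<in> Y (arity (us ! s))"
  shows "operad_comp w us \<in> Y (sum_list (map arity us))"
proof -
  let ?N = "sum_list (map arity us)" and ?v = "vars (operad_comp w us)"
  have "set ?v = {..<?N}"
  proof (intro set_eqI iffI)
    fix p assume "p \<in> set ?v"
    then obtain s i where "s \<in> set (vars w)" "i \<in> set (vars (us ! s))" "p = offset (map arity us)
        s + i"
      by (auto simp: operad_comp_def vars_subst)
    then show "p \<in> {..<?N}"
      using w us[of s] offset_less[of s "map arity us" i] by (simp add: Y_vars)
  next
    fix p assume "p \<in> {..<?N}"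
    then have "p < ?N" by simp
    then obtain s i where "s < length (map arity us)" "i < map arity us ! s" "p = offset (map
        arity us) s + i"
      by (rule offset_cases)
    then show "p \<in> set ?v"
      using w us[of s] by (force simp: operad_comp_def vars_subst Y_vars)
  qed
  moreover have "length ?v = ?N"
    using arity_operad_comp[OF w] by (simp add: arity_def)
  ultimately show ?thesis by (simp add: Y_def card_distinct)
qed

lemma operad_act_id: "operad_act w id = w"
  by (simp add: operad_act_def word.map_id)

lemma operad_act_comp:
  assumes "\<sigma> permutes A" "\<tau> permutes A"
  shows "operad_act (operad_act w \<sigma>) \<tau> = operad_act w (\<sigma> \<circ> \<tau>)"
  using o_inv_distrib[OF permutes_bij[OF assms(1)] permutes_bij[OF assms(2)]]
  by (simp add: operad_act_def map_word_comp comp_def)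

lemma operad_comp_unit_left: "operad_comp operad_unit [w] = w"
  by (simp add: operad_comp_def operad_unit_def offset_def map_word_as_subst)

lemma operad_comp_unit_right:
  assumes "w \<in> Y n"
  shows "operad_comp w (replicate n operad_unit) = w"
proof -
  have "operad_comp w (replicate n operad_unit) = subst Var w"
    unfolding operad_comp_def
  proof (rule subst_cong)
    fix s assume "s \<in> set (vars w)"
    then have "s < n" using assms by (simp add: Y_vars)
    moreover have "arity operad_unit = 1" by (simp add: arity_def operad_unit_def)
    ultimately show "map_word (\<lambda>i. offset (map arity (replicate n operad_unit)) s + i)
        (replicate n operad_unit ! s) = Var s"
      by (simp add: offset_def sum_list_replicate operad_unit_def)
  qed
  then show ?thesis by simp
qed

lemma operad_comp_assoc:
  assumes w: "w \<in> Y (length us)" and len: "length vss = length us"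
    and us: "\<And>s. s < length us \<Longrightarrow> us ! s \<in> Y (length (vss ! s))"
  shows "operad_comp (operad_comp w us) (concat vss) = operad_comp w (map2 operad_comp us vss)"
  unfolding operad_comp_def[of _ "concat vss"] operad_comp_def[of w] subst_subst
proof (rule subst_cong)
  fix s assume "s \<in> set (vars w)"
  then have s: "s < length us" using w by (simp add: Y_vars)
  have lens: "map arity us = map length vss"
    using len us Y_arity by (intro nth_equalityI) auto
  have sums: "map arity (map2 operad_comp us vss) = map sum_list (map (map arity) vss)"
    using len us arity_operad_comp by (intro nth_equalityI) auto
  have off: "offset (map arity (concat vss)) (offset (map length vss) s + i) =
      offset (map sum_list (map (map arity) vss)) s + offset (map arity (vss ! s)) i"
    if "i < length (vss ! s)" for i
    using offset_concat[of s "map (map arity) vss" i] that s len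
    by (simp add: map_concat comp_def)
  show "subst (\<lambda>p. map_word (\<lambda>i. offset (map arity (concat vss)) p + i) (concat vss ! p))
      (map_word (\<lambda>i. offset (map arity us) s + i) (us ! s)) =
    map_word (\<lambda>i. offset (map arity (map2 operad_comp us vss)) s + i) (map2 operad_comp us vss ! s)"
    unfolding lens sums using s len us[OF s]
    by (auto simp: subst_map_word operad_comp_def map_word_subst map_word_comp Y_vars off
        nth_concat_offset add.assoc intro!: subst_cong map_word_cong_vars)
qed

text \<open>
  The variable \<open>s\<close> of \<open>w\<close> is renamed to \<open>inv \<sigma> s\<close>, and the word at that index in the permuted
  list is again \<open>us ! s\<close>; only the start of its block has changed, in the way recorded by
  \<open>block_perm_offset\<close>.
\<close>

lemma operad_comp_act_outer:
  assumes w: "w \<in> Y (length us)" and \<sigma>: "\<sigma> permutes {..<length us}"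
    and us: "\<And>s. s < length us \<Longrightarrow> us ! s \<in> Y (arity (us ! s))"
  shows "operad_comp (operad_act w \<sigma>) (permute_list \<sigma> us) =
    operad_act (operad_comp w us) (block_perm \<sigma> (map arity us))"
  unfolding operad_act_def operad_comp_def subst_map_word map_word_subst map_word_comp
proof (rule subst_cong)
  let ?js = "map arity us"
  fix s assume "s \<in> set (vars w)"
  then have s: "s < length us" using w by (simp add: Y_vars)
  define t where "t = inv \<sigma> s"
  have t: "t < length us" "\<sigma> t = s"
    using \<sigma> s permutes_in_image[OF permutes_inv[OF \<sigma>], of s]
    by (auto simp: t_def permutes_inverses)
  have \<sigma>': "\<sigma> permutes {..<length ?js}" using \<sigma> by simp
  have "inv (block_perm \<sigma> ?js) (offset ?js s + i) = offset (permute_list \<sigma> ?js) t + i"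
    if "i < arity (us ! s)" for i
    using block_perm_offset[OF \<sigma>', of t i] that t s permutes_inj[OF block_perm_permutes[OF \<sigma>']]
    by (intro inv_f_eq) simp_all
  then show "map_word (\<lambda>i. offset (map arity (permute_list \<sigma> us)) (inv \<sigma> s) + i)
      (permute_list \<sigma> us ! inv \<sigma> s) =
    map_word (\<lambda>i. inv (block_perm \<sigma> ?js) (offset ?js s + i)) (us ! s)"
    using t s us[OF s] \<sigma>
    by (auto simp: permute_list_map permute_list_nth Y_vars simp flip: t_def intro!:
        map_word_cong_vars)
qed

lemma operad_comp_act_inner:
  assumes w: "w \<in> Y (length us)" and len: "length \<tau>s = length us"
    and us: "\<And>s. s < length us \<Longrightarrow> us ! s \<in> Y (arity (us ! s))"
    and \<tau>s: "\<And>s. s < length us \<Longrightarrow> \<tau>s ! s permutes {..<arity (us ! s)}"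
  shows "operad_comp w (map2 operad_act us \<tau>s) =
    operad_act (operad_comp w us) (sum_perm \<tau>s (map arity us))"
  unfolding operad_act_def[of "operad_comp w us"]
  unfolding operad_comp_def map_word_subst map_word_comp
proof (rule subst_cong)
  let ?js = "map arity us"
  fix s assume "s \<in> set (vars w)"
  then have s: "s < length us" using w by (simp add: Y_vars)
  have lens: "map arity (map2 operad_act us \<tau>s) = ?js"
    using len by (intro nth_equalityI) (simp_all add: arity_def operad_act_def)
  have perm: "sum_perm \<tau>s ?js permutes {..<sum_list ?js}"
    using \<tau>s by (intro sum_perm_permutes) simp
  have "inv (sum_perm \<tau>s ?js) (offset ?js s + i) = offset ?js s + inv (\<tau>s ! s) i"
    if "i < arity (us ! s)" for i
  proof (rule inv_f_eq[OF permutes_inj[OF perm]])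
    have "inv (\<tau>s ! s) i < arity (us ! s)"
      using permutes_in_image[OF permutes_inv[OF \<tau>s[OF s]], of i] that by simp
    then show "sum_perm \<tau>s ?js (offset ?js s + inv (\<tau>s ! s) i) = offset ?js s + i"
      using s permutes_inverses(1)[OF \<tau>s[OF s]] by (simp add: sum_perm_offset)
  qed
  then show "map_word (\<lambda>i. offset (map arity (map2 operad_act us \<tau>s)) s + i) (map2 operad_act us
      \<tau>s ! s) =
    map_word (\<lambda>i. inv (sum_perm \<tau>s ?js) (offset ?js s + i)) (us ! s)"
    using s len us[OF s] unfolding lens
    by (auto simp: operad_act_def map_word_comp Y_vars intro!: map_word_cong_vars)
qed

section \<open>Action and composition of words on tuples\<close>

lemma concat_map_concat: "concat (map concat xsss) = concat (concat xsss)"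
  by (induction xsss) auto

lemma concat_map_singleton: "concat (map (\<lambda>x. [x]) xs) = xs"
  by (induction xs) auto

context symmetric_monoidal_category begin

lemma parallel_Y: "u \<in> Y n \<Longrightarrow> v \<in> Y n \<Longrightarrow> parallel n u v"
  by (auto simp: Y_def parallel_def)

lemma eval_obj_map_word:
  "(\<And>i. i \<in> set (vars w) \<Longrightarrow> xs ! f i = ys ! i) \<Longrightarrow> eval_obj C (map_word f w) xs = eval_obj C w ys"
  by (induction w) auto

lemma eval_arr_map_word:
  "(\<And>i. i \<in> set (vars w) \<Longrightarrow> fs ! f i = gs ! i) \<Longrightarrow> eval_arr C (map_word f w) fs = eval_arr C w gs"
  by (induction w) auto

lemma permute_list_inv_nth:
  "\<sigma> permutes {..<length xs} \<Longrightarrow> i < length xs \<Longrightarrow> permute_list \<sigma> xs ! inv \<sigma> i = xs ! i"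
  using permutes_in_image[OF permutes_inv, of \<sigma> "{..<length xs}" i]
  by (simp add: permute_list_nth permutes_inverses)

lemma eval_obj_act:
  "w \<in> Y (length xs) \<Longrightarrow> \<sigma> permutes {..<length xs} \<Longrightarrow>
    eval_obj C (operad_act w \<sigma>) (permute_list \<sigma> xs) = eval_obj C w xs"
  unfolding operad_act_def by (rule eval_obj_map_word) (simp add: Y_vars permute_list_inv_nth)

lemma eval_arr_act:
  "w \<in> Y (length fs) \<Longrightarrow> \<sigma> permutes {..<length fs} \<Longrightarrow>
    eval_arr C (operad_act w \<sigma>) (permute_list \<sigma> fs) = eval_arr C w fs"
  unfolding operad_act_def by (rule eval_arr_map_word) (simp add: Y_vars permute_list_inv_nth)

text \<open>
  Renaming the variables of both words and permuting the tuple accordingly changes nothing. This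
  brings two coherence isomorphisms to a common tuple when only the tuples differ by a
  permutation.
\<close>

lemma coh_act:
  assumes u: "u \<in> Y (length xs)" and v: "v \<in> Y (length xs)" and xs: "set xs \<subseteq> obj C"
    and \<sigma>: "\<sigma> permutes {..<length xs}"
  shows "coh (operad_act u \<sigma>) (operad_act v \<sigma>) (permute_list \<sigma> xs) = coh u v xs"
proof -
  have "xs = map (\<lambda>s. eval_obj C (Var (inv \<sigma> s)) (permute_list \<sigma> xs)) [0..<length xs]"
    using \<sigma> by (intro nth_equalityI) (simp_all add: permute_list_inv_nth)
  then have "coh u v xs =
      coh u v (map (\<lambda>s. eval_obj C (Var (inv \<sigma> s)) (permute_list \<sigma> xs)) [0..<length xs])"
    by simp
  also have "\<dots> = coh (operad_act u \<sigma>) (operad_act v \<sigma>) (permute_list \<sigma> xs)"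
    unfolding operad_act_def map_word_as_subst
  proof (rule coh_subst)
    show "parallel (length (permute_list \<sigma> xs)) (subst (\<lambda>i. Var (inv \<sigma> i)) u)
        (subst (\<lambda>i. Var (inv \<sigma> i)) v)"
      using parallel_Y[OF operad_act_in_Y[OF u \<sigma>] operad_act_in_Y[OF v \<sigma>]]
      by (simp add: operad_act_def map_word_as_subst)
  qed (use xs \<sigma> parallel_Y[OF u v] permutes_in_image[OF permutes_inv[OF \<sigma>]] in auto)
  finally show ?thesis ..
qed

lemma operad_comp_in_Y_concat:
  assumes "w \<in> Y (length xss)" "length us = length xss"
    "\<And>s. s < length xss \<Longrightarrow> us ! s \<in> Y (length (xss ! s))"
  shows "operad_comp w us \<in> Y (length (concat xss))"
proof -
  have "map arity us = map length xss"
    using assms(2,3) Y_arity by (intro nth_equalityI) auto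
  moreover have "us ! s \<in> Y (arity (us ! s))" if "s < length us" for s
    using assms(2,3) that Y_arity by (metis)
  ultimately show ?thesis
    using operad_comp_in_Y[of w us] assms(1,2) by (simp add: length_concat)
qed

lemma operad_comp_offsets:
  assumes "length us = length xss" "\<And>s. s < length xss \<Longrightarrow> us ! s \<in> Y (length (xss ! s))"
  shows "operad_comp w us = subst (\<lambda>s. map_word (\<lambda>i. offset (map length xss) s + i) (us ! s)) w"
proof -
  have "map arity us = map length xss"
    using assms Y_arity by (intro nth_equalityI) auto
  then show ?thesis by (simp add: operad_comp_def)
qed

lemma eval_obj_block:
  assumes "s < length xss" "w \<in> Y (length (xss ! s))"
  shows "eval_obj C (map_word (\<lambda>i. offset (map length xss) s + i) w) (concat xss) = eval_obj C w
      (xss ! s)"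
  using assms by (intro eval_obj_map_word) (simp add: Y_vars nth_concat_offset)

lemma eval_arr_block:
  assumes "s < length fss" "w \<in> Y (length (fss ! s))"
  shows "eval_arr C (map_word (\<lambda>i. offset (map length fss) s + i) w) (concat fss) = eval_arr C w
      (fss ! s)"
  using assms by (intro eval_arr_map_word) (simp add: Y_vars nth_concat_offset)

lemma eval_obj_comp:
  assumes w: "w \<in> Y (length xss)" and us: "length us = length xss"
      "\<And>s. s < length xss \<Longrightarrow> us ! s \<in> Y (length (xss ! s))"
    and as: "length as = length xss" "\<And>s. s < length xss \<Longrightarrow> as ! s = eval_obj C (us ! s) (xss ! s)"
  shows "eval_obj C (operad_comp w us) (concat xss) = eval_obj C w as"
proof -
  have "map (\<lambda>s. eval_obj C (map_word (\<lambda>i. offset (map length xss) s + i) (us ! s)) (concat xss))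
      [0..<length xss] = as"
    using us(2) as by (intro nth_equalityI) (simp_all add: eval_obj_block)
  then show ?thesis
    using w by (simp add: operad_comp_offsets[OF us] eval_obj_subst[where n = "length xss"] Y_def)
qed

lemma eval_arr_comp:
  assumes w: "w \<in> Y (length fss)" and us: "length us = length fss"
      "\<And>s. s < length fss \<Longrightarrow> us ! s \<in> Y (length (fss ! s))"
    and as: "length as = length fss" "\<And>s. s < length fss \<Longrightarrow> as ! s = eval_arr C (us ! s) (fss ! s)"
  shows "eval_arr C (operad_comp w us) (concat fss) = eval_arr C w as"
proof -
  have "eval_arr C (subst (\<lambda>s. map_word (\<lambda>i. offset (map length fss) s + i) (us ! s)) w) (concat
      fss) =
      eval_arr C w as"
    if "set (vars w) \<subseteq> {..<length fss}" for w
    using that us(2) as(2) by (induction w) (simp_all add: eval_arr_block)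
  with w show ?thesis by (simp add: operad_comp_offsets[OF us] Y_def)
qed

lemma block_in_range:
  assumes "s < length xss" "w \<in> Y (length (xss ! s))"
  shows "set (vars (map_word (\<lambda>i. offset (map length xss) s + i) w)) \<subseteq> {..<length (concat xss)}"
  using assms offset_less[of s "map length xss"] by (auto simp: length_concat Y_vars)

text \<open>
  In a composite, the word in slot \<open>s\<close> sees the block \<open>xss ! s\<close> of the concatenated tuple.
\<close>

lemma coh_block:
  assumes s: "s < length xss" and u: "u \<in> Y (length (xss ! s))" and v: "v \<in> Y (length (xss ! s))"
    and xss: "set (concat xss) \<subseteq> obj C"
  shows "coh (map_word (\<lambda>i. offset (map length xss) s + i) u)
      (map_word (\<lambda>i. offset (map length xss) s + i) v) (concat xss) = coh u v (xss ! s)"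
    and "parallel (length (concat xss)) (map_word (\<lambda>i. offset (map length xss) s + i) u)
      (map_word (\<lambda>i. offset (map length xss) s + i) v)"
proof -
  let ?f = "\<lambda>i. offset (map length xss) s + i"
  show p: "parallel (length (concat xss)) (map_word ?f u) (map_word ?f v)"
    using block_in_range[OF s u] u v by (auto simp: parallel_def Y_def distinct_map)
  have "xss ! s = map (\<lambda>i. eval_obj C (Var (?f i)) (concat xss)) [0..<length (xss ! s)]"
    using s by (intro nth_equalityI) (simp_all add: nth_concat_offset)
  then have "coh u v (xss ! s) =
      coh u v (map (\<lambda>i. eval_obj C (Var (?f i)) (concat xss)) [0..<length (xss ! s)])"
    by simp
  also have "\<dots> = coh (map_word ?f u) (map_word ?f v) (concat xss)"
    unfolding map_word_as_subst
    using parallel_Y[OF u v] p xss s offset_less[of s "map length xss"]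
    by (intro coh_subst) (auto simp: map_word_as_subst length_concat)
  finally show "coh (map_word ?f u) (map_word ?f v) (concat xss) = coh u v (xss ! s)" ..
qed

text \<open>
  The entries of \<open>as\<close> are the values at \<open>concat xss\<close> of the words \<open>us\<close> shifted to their blocks,
  so this is a case of \<open>coh_subst\<close>.
\<close>

lemma coh_comp_outer:
  assumes u: "u \<in> Y (length xss)" and v: "v \<in> Y (length xss)" and us: "length us = length xss"
      "\<And>s. s < length xss \<Longrightarrow> us ! s \<in> Y (length (xss ! s))"
    and xss: "set (concat xss) \<subseteq> obj C"
    and as: "length as = length xss" "\<And>s. s < length xss \<Longrightarrow> as ! s = eval_obj C (us ! s) (xss ! s)"
  shows "coh u v as = coh (operad_comp u us) (operad_comp v us) (concat xss)"
proof -
  let ?\<rho> = "\<lambda>s. map_word (\<lambda>i. offset (map length xss) s + i) (us ! s)"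
  have offsets: "operad_comp w us = subst ?\<rho> w" for w
    using us by (rule operad_comp_offsets)
  have Y: "operad_comp u us \<in> Y (length (concat xss))" "operad_comp v us \<in> Y (length (concat xss))"
    using u v us by (blast intro: operad_comp_in_Y_concat)+
  have "as = map (\<lambda>s. eval_obj C (?\<rho> s) (concat xss)) [0..<length xss]"
    using us(2) as by (intro nth_equalityI) (simp_all add: eval_obj_block)
  also have "coh u v \<dots> = coh (operad_comp u us) (operad_comp v us) (concat xss)"
    using parallel_Y[OF Y] unfolding offsets
    by (intro coh_subst[OF parallel_Y[OF u v]] block_in_range us(2) xss)
  finally show ?thesis .
qed

text \<open>
  A word applied to coherence isomorphisms is again a coherence isomorphism. Together with
  \<open>coh_comp_outer\<close> this reduces every canonical part of a multicategory axiom to a composite of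
  coherence isomorphisms at one tuple.
\<close>

lemma coh_comp_inner:
  assumes w: "w \<in> Y (length xss)" and us: "length us = length xss"
      "\<And>s. s < length xss \<Longrightarrow> us ! s \<in> Y (length (xss ! s))"
    and vs: "length vs = length xss" "\<And>s. s < length xss \<Longrightarrow> vs ! s \<in> Y (length (xss ! s))"
    and xss: "set (concat xss) \<subseteq> obj C"
    and cs: "length cs = length xss" "\<And>s. s < length xss \<Longrightarrow> cs ! s = coh (us ! s) (vs ! s) (xss ! s)"
  shows "eval_arr C w cs = coh (operad_comp w us) (operad_comp w vs) (concat xss)"
proof -
  let ?\<rho> = "\<lambda>us s. map_word (\<lambda>i. offset (map length xss) s + i) (us ! s)"
  have offsets: "operad_comp w us = subst (?\<rho> us) w" "operad_comp w vs = subst (?\<rho> vs) w"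
    using us vs by (blast intro: operad_comp_offsets)+
  have Y: "operad_comp w us \<in> Y (length (concat xss))" "operad_comp w vs \<in> Y (length (concat xss))"
    using w us vs by (blast intro: operad_comp_in_Y_concat)+
  have "cs = map (\<lambda>s. coh (?\<rho> us s) (?\<rho> vs s) (concat xss)) [0..<length xss]"
    using us(2) vs(2) xss cs by (intro nth_equalityI) (simp_all only: length_map length_upt
        nth_map nth_upt coh_block diff_zero add_0)
  also have "eval_arr C w \<dots> = coh (operad_comp w us) (operad_comp w vs) (concat xss)"
    using parallel_Y[OF Y] w unfolding offsets
    by (intro coh_subst_inner coh_block(2) us(2) vs(2) xss) (auto simp: Y_def)
  finally show ?thesis .
qed

end

section \<open>Structure maps of the multicategory\<close>

locale word_choice = symmetric_monoidal_category C
  for C :: "('o, 'a) smc_data" (structure) +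
  fixes \<kappa> :: "nat \<Rightarrow> 'o list \<Rightarrow> nat word"
  assumes word_in_Y: "set xs \<subseteq> obj C \<Longrightarrow> \<kappa> (length xs) xs \<in> Y (length xs)"
begin

abbreviation k :: "'o list \<Rightarrow> nat word" where "k \<equiv> kword \<kappa>"
abbreviation bar :: "'o list \<Rightarrow> 'o" where "bar \<equiv> kbar C \<kappa>"
abbreviation \<theta> :: "'o list \<Rightarrow> (nat \<Rightarrow> nat) \<Rightarrow> 'a" where "\<theta> \<equiv> U_theta C \<kappa>"
abbreviation \<phi> :: "'o list list \<Rightarrow> 'o list \<Rightarrow> 'a" where "\<phi> \<equiv> U_phi C \<kappa>"

lemma k_in_Y [simp]: "set xs \<subseteq> obj C \<Longrightarrow> k xs \<in> Y (length xs)"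
  by (simp add: word_in_Y kword_def)

lemma k_in_Y_nth:
  assumes "set (concat xss) \<subseteq> obj C" "s < length xss"
  shows "k (xss ! s) \<in> Y (length (xss ! s))"
  using assms nth_mem[OF assms(2)] by (intro k_in_Y) (auto simp: subset_eq)

lemma bar_obj [simp]: "set xs \<subseteq> obj C \<Longrightarrow> bar xs \<in> obj C"
  using k_in_Y[of xs] by (simp add: kbar_def Y_def)

lemma unit_typed:
  assumes "a \<in> obj C"
  shows "arr (U_unit C \<kappa> a)" "src (U_unit C \<kappa> a) = bar [a]" "trg (U_unit C \<kappa> a) = a"
proof -
  have "parallel (length [a]) (k [a]) operad_unit"
    using k_in_Y[of "[a]"] assms by (intro parallel_Y) (auto simp: Y_def operad_unit_def)
  from coh_typed[OF this] assms
  show "arr (U_unit C \<kappa> a)" "src (U_unit C \<kappa> a) = bar [a]" "trg (U_unit C \<kappa> a) = a"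
    by (simp_all add: U_unit_def kbar_def operad_unit_def)
qed

context
  fixes xs :: "'o list" and \<sigma> :: "nat \<Rightarrow> nat"
  assumes xs: "set xs \<subseteq> obj C" and \<sigma>: "\<sigma> permutes {..<length xs}"
begin

lemma permuted_words:
  "set (permute_list \<sigma> xs) \<subseteq> obj C"
  "k (permute_list \<sigma> xs) \<in> Y (length xs)" "operad_act (k xs) \<sigma> \<in> Y (length xs)"
  "parallel (length (permute_list \<sigma> xs)) (k (permute_list \<sigma> xs)) (operad_act (k xs) \<sigma>)"
proof -
  show *: "set (permute_list \<sigma> xs) \<subseteq> obj C" using xs \<sigma> by simp
  show Y: "k (permute_list \<sigma> xs) \<in> Y (length xs)" "operad_act (k xs) \<sigma> \<in> Y (length xs)"
    using k_in_Y[OF *] operad_act_in_Y[OF k_in_Y[OF xs] \<sigma>] by simp_all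
  then show "parallel (length (permute_list \<sigma> xs)) (k (permute_list \<sigma> xs)) (operad_act (k xs) \<sigma>)"
    by (simp add: parallel_Y)
qed

lemma theta_typed:
  "arr (\<theta> xs \<sigma>)" "src (\<theta> xs \<sigma>) = bar (permute_list \<sigma> xs)" "trg (\<theta> xs \<sigma>) = bar xs"
  using coh_typed[OF permuted_words(4,1)] eval_obj_act[OF k_in_Y[OF xs] \<sigma>]
  by (simp_all add: U_theta_def kbar_def)

text \<open>
  By \<open>coh_act\<close> the first factor may be evaluated at the tuple of the second, and then both sides
  are the coherence isomorphism to the word of \<open>xs\<close> acted on by \<open>\<sigma> \<circ> \<tau>\<close>.
\<close>

lemma theta_comp:
  assumes \<tau>: "\<tau> permutes {..<length xs}"
  shows "\<theta> xs \<sigma> \<cdot> \<theta> (permute_list \<sigma> xs) \<tau> = \<theta> xs (\<sigma> \<circ> \<tau>)"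
proof -
  let ?ys = "permute_list \<sigma> xs" and ?zs = "permute_list \<tau> (permute_list \<sigma> xs)"
  have \<tau>': "\<tau> permutes {..<length ?ys}" using \<tau> by simp
  have zs: "set ?zs \<subseteq> obj C" using permuted_words(1) \<tau> by simp
  have Y: "k ?zs \<in> Y (length ?zs)" "operad_act (k ?ys) \<tau> \<in> Y (length ?zs)"
    "operad_act (operad_act (k xs) \<sigma>) \<tau> \<in> Y (length ?zs)"
    using k_in_Y[OF zs] operad_act_in_Y[OF permuted_words(2) \<tau>] operad_act_in_Y[OF
        permuted_words(3) \<tau>]
    by simp_all
  have "\<theta> xs \<sigma> = coh (operad_act (k ?ys) \<tau>) (operad_act (operad_act (k xs) \<sigma>) \<tau>) ?zs"
    unfolding U_theta_def using permuted_words \<tau>'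
    by (intro coh_act[symmetric]) simp_all
  then have "\<theta> xs \<sigma> \<cdot> \<theta> ?ys \<tau> = coh (k ?zs) (operad_act (operad_act (k xs) \<sigma>) \<tau>) ?zs"
    using coh_trans[OF parallel_Y[OF Y(1,2)] parallel_Y[OF Y(2,3)] zs]
    by (simp add: U_theta_def)
  also have "\<dots> = \<theta> xs (\<sigma> \<circ> \<tau>)"
    using \<sigma> \<tau> by (simp add: U_theta_def operad_act_comp permute_list_compose)
  finally show ?thesis .
qed

end

lemma theta_id: "set xs \<subseteq> obj C \<Longrightarrow> \<theta> xs id = ident C (bar xs)"
  using coh_refl[OF parallel_Y[OF k_in_Y k_in_Y]] by (simp add: U_theta_def operad_act_id kbar_def)

context
  fixes xss :: "'o list list" and ys :: "'o list"
  assumes xss: "set (concat xss) \<subseteq> obj C" and ys: "set ys \<subseteq> obj C" and len: "length xss = length ys"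
begin

lemma composite_words:
  "k (concat xss) \<in> Y (length (concat xss))"
  "operad_comp (k ys) (map k xss) \<in> Y (length (concat xss))"
  using k_in_Y[OF xss] k_in_Y[OF ys] len k_in_Y_nth[OF xss]
  by (auto intro: operad_comp_in_Y_concat)

lemma phi_typed:
  "arr (\<phi> xss ys)" "src (\<phi> xss ys) = bar (concat xss)"
  "trg (\<phi> xss ys) = eval_obj C (k ys) (map bar xss)"
proof -
  have "eval_obj C (operad_comp (k ys) (map k xss)) (concat xss) = eval_obj C (k ys) (map bar xss)"
    using k_in_Y[OF ys] len k_in_Y_nth[OF xss] by (intro eval_obj_comp) (auto simp: kbar_def)
  then show "arr (\<phi> xss ys)" "src (\<phi> xss ys) = bar (concat xss)"
    "trg (\<phi> xss ys) = eval_obj C (k ys) (map bar xss)"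
    using coh_typed[OF parallel_Y[OF composite_words] xss] by (simp_all add: U_phi_def kbar_def)
qed

text \<open>
  The common right-hand side of both equivariance axioms, as a single coherence isomorphism.
\<close>

lemma phi_theta:
  assumes b: "b permutes {..<length (concat xss)}"
  shows "\<phi> xss ys \<cdot> \<theta> (concat xss) b = coh (k (permute_list b (concat xss)))
    (operad_act (operad_comp (k ys) (map k xss)) b) (permute_list b (concat xss))"
proof -
  have "\<phi> xss ys = coh (operad_act (k (concat xss)) b)
      (operad_act (operad_comp (k ys) (map k xss)) b) (permute_list b (concat xss))"
    unfolding U_phi_def by (rule coh_act[OF composite_words xss b, symmetric])
  then show ?thesis
    using coh_trans[OF permuted_words(4)[OF xss b] _ permuted_words(1)[OF xss b],
        of "operad_act (operad_comp (k ys) (map k xss)) b"]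
      parallel_Y[OF permuted_words(3)[OF xss b] operad_act_in_Y[OF composite_words(2) b]]
    by (simp add: U_theta_def)
qed

end

text \<open>
  Naturality of \<open>\<theta> ys \<sigma>\<close> moves the arrows \<open>fs\<close> to the left, where the action on words undoes
  their permutation. The remaining coherence isomorphisms have the same target by
  \<open>operad_comp_act_outer\<close>.
\<close>

lemma phi_act_outer:
  assumes xss: "set (concat xss) \<subseteq> obj C" and fs: "\<forall>f \<in> set fs. arr f" "map src fs = map bar xss"
    and \<sigma>: "\<sigma> permutes {..<length fs}"
  defines "ys \<equiv> map trg fs"
  shows "\<theta> ys \<sigma> \<cdot> eval_arr C (k (permute_list \<sigma> ys)) (permute_list \<sigma> fs) \<cdot>
      \<phi> (permute_list \<sigma> xss) (permute_list \<sigma> ys) =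
    eval_arr C (k ys) fs \<cdot> \<phi> xss ys \<cdot> \<theta> (concat xss) (block_perm \<sigma> (map length xss))"
proof -
  let ?b = "block_perm \<sigma> (map length xss)" and ?u = "k (permute_list \<sigma> ys)"
    and ?v = "operad_act (k ys) \<sigma>" and ?xss = "permute_list \<sigma> xss" and ?ys = "permute_list \<sigma> ys"
  have len: "length xss = length fs" "length ys = length fs"
    using map_eq_imp_length_eq[OF fs(2)] by (simp_all add: ys_def)
  have ys: "set ys \<subseteq> obj C" using fs(1) by (auto simp: ys_def)
  have \<sigma>s: "\<sigma> permutes {..<length xss}" "\<sigma> permutes {..<length ys}" using \<sigma> len by simp_all
  have ys': "set ?ys \<subseteq> obj C" and u: "?u \<in> Y (length fs)" and v: "?v \<in> Y (length fs)"
    using permuted_words[OF ys \<sigma>s(2)] len by simp_all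
  have xss': "set (concat ?xss) \<subseteq> obj C" using xss \<sigma>s by simp
  have len': "length ?xss = length ?ys" using len by simp
  have b: "?b permutes {..<length (concat xss)}"
    using block_perm_permutes[of \<sigma> "map length xss"] \<sigma>s by (simp add: length_concat)
  have fs': "\<forall>f \<in> set (permute_list \<sigma> fs). arr f" using fs(1) \<sigma> by simp
  have maps: "map trg (permute_list \<sigma> fs) = ?ys" "map src (permute_list \<sigma> fs) = map bar ?xss"
    using permute_list_map[OF \<sigma>, of trg] permute_list_map[OF \<sigma>, of src]
      permute_list_map[OF \<sigma>s(1), of bar] fs(2) by (simp_all add: ys_def)
  have natural: "\<theta> ys \<sigma> \<cdot> eval_arr C ?u (permute_list \<sigma> fs) = eval_arr C (k ys) fs \<cdot> coh ?u ?v
      (map bar ?xss)"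
    using coh_natural[of "permute_list \<sigma> fs" ?u ?v] fs' parallel_Y[OF u v] maps
      eval_arr_act[of "k ys" fs \<sigma>] k_in_Y[OF ys] \<sigma> len
    by (simp add: U_theta_def)
  have par: "parallel (length (map bar ?xss)) ?u ?v" using parallel_Y[OF u v] len by simp
  have bars: "set (map bar ?xss) \<subseteq> obj C" using xss' by (auto simp: subset_eq)
  have acted: "eval_obj C ?v (map bar ?xss) = eval_obj C (k ys) (map bar xss)"
    using eval_obj_act[of "k ys" "map bar xss" \<sigma>] k_in_Y[OF ys] len \<sigma> permute_list_map[OF \<sigma>s(1),
        of bar]
    by simp
  have blocks: "coh ?u ?v (map bar ?xss) =
      coh (operad_comp ?u (map k ?xss)) (operad_comp ?v (map k ?xss)) (concat ?xss)"
    using u v len k_in_Y_nth[OF xss'] xss' by (intro coh_comp_outer) (simp_all add: kbar_def)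
  have Yv: "operad_comp ?v (map k ?xss) \<in> Y (length (concat ?xss))"
    using v len k_in_Y_nth[OF xss'] by (intro operad_comp_in_Y_concat) simp_all
  note Yu = composite_words[OF xss' ys' len']
  have "map arity (map k xss) = map length xss"
    using k_in_Y_nth[OF xss] Y_arity by (intro nth_equalityI) auto
  moreover have "map k xss ! s \<in> Y (arity (map k xss ! s))" if "s < length (map k xss)" for s
    using k_in_Y_nth[OF xss, of s] that Y_arity by auto
  ultimately have words: "operad_comp ?v (map k ?xss) = operad_act (operad_comp (k ys) (map k
      xss)) ?b"
    using operad_comp_act_outer[of "k ys" "map k xss" \<sigma>] k_in_Y[OF ys] len \<sigma>
      permute_list_map[OF \<sigma>s(1), of k] by (simp del: map_map)
  have "\<theta> ys \<sigma> \<cdot> eval_arr C ?u (permute_list \<sigma> fs) \<cdot> \<phi> ?xss ?ys =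
      (\<theta> ys \<sigma> \<cdot> eval_arr C ?u (permute_list \<sigma> fs)) \<cdot> \<phi> ?xss ?ys"
    using phi_typed[OF xss' ys' len'] theta_typed[OF ys \<sigma>s(2)] u fs' maps
    by (simp add: kbar_def Y_def)
  also have "\<dots> = eval_arr C (k ys) fs \<cdot> coh ?u ?v (map bar ?xss) \<cdot> \<phi> ?xss ?ys"
    unfolding natural
    using phi_typed[OF xss' ys' len'] k_in_Y[OF ys] fs len coh_typed[OF par bars] acted
    by (simp add: Y_def)
  also have "coh ?u ?v (map bar ?xss) \<cdot> \<phi> ?xss ?ys =
      coh (k (concat ?xss)) (operad_comp ?v (map k ?xss)) (concat ?xss)"
    unfolding blocks U_phi_def by (rule coh_trans[OF parallel_Y[OF Yu] parallel_Y[OF Yu(2) Yv]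
        xss'])
  also have "\<dots> = \<phi> xss ys \<cdot> \<theta> (concat xss) ?b"
    using phi_theta[OF xss ys _ b] len permute_list_concat[OF \<sigma>s(1)] by (simp add: words)
  finally show ?thesis .
qed

text \<open>
  The arrows \<open>\<theta>\<close> of the inner tuples are coherence isomorphisms, so applying the word of \<open>ys\<close> to
  them gives another one by \<open>coh_comp_inner\<close>; its target is identified by
  \<open>operad_comp_act_inner\<close>.
\<close>

lemma phi_act_inner:
  assumes xss: "set (concat xss) \<subseteq> obj C" and fs: "\<forall>f \<in> set fs. arr f" "map src fs = map bar xss"
    and ys: "map trg fs = ys"
    and \<tau>s: "length \<tau>s = length xss" "\<And>s. s < length xss \<Longrightarrow> \<tau>s ! s permutes {..<length (xss ! s)}"
  shows "eval_arr C (k ys) (map2 (\<cdot>) fs (map2 \<theta> xss \<tau>s)) \<cdot> \<phi> (map2 permute_list \<tau>s xss) ys =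
    eval_arr C (k ys) fs \<cdot> \<phi> xss ys \<cdot> \<theta> (concat xss) (sum_perm \<tau>s (map length xss))"
proof -
  let ?b = "sum_perm \<tau>s (map length xss)" and ?xss = "map2 permute_list \<tau>s xss"
    and ?acted = "map2 operad_act (map k xss) \<tau>s"
  have len: "length xss = length fs" "length ys = length fs"
    using map_eq_imp_length_eq[OF fs(2)] ys by auto
  have ys_obj: "set ys \<subseteq> obj C" using fs(1) ys by auto
  have b: "?b permutes {..<length (concat xss)}"
    using sum_perm_permutes[of "map length xss" \<tau>s] \<tau>s by (simp add: length_concat)
  have concat: "permute_list ?b (concat xss) = concat ?xss" using \<tau>s by (rule concat_permute_list)
  have xs: "set (xss ! s) \<subseteq> obj C" if "s < length xss" for s
    using xss nth_mem[OF that] by (auto simp: subset_eq)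
  have xss': "set (concat ?xss) \<subseteq> obj C"
    using permuted_words(1)[OF xss b] unfolding concat .
  have len': "length ?xss = length ys" using len \<tau>s by simp
  have nth: "?xss ! s = permute_list (\<tau>s ! s) (xss ! s)" if "s < length xss" for s
    using that \<tau>s by simp
  have acted: "?acted ! s \<in> Y (length (?xss ! s))" if "s < length ?xss" for s
    using that permuted_words(3)[OF xs \<tau>s(2)] \<tau>s(1) by simp
  have \<theta>s: "\<forall>f \<in> set (map2 \<theta> xss \<tau>s). arr f" "map trg (map2 \<theta> xss \<tau>s) = map bar xss"
    "map src (map2 \<theta> xss \<tau>s) = map bar ?xss"
    using theta_typed[OF xs \<tau>s(2)] \<tau>s(1) by (auto simp: in_set_conv_nth intro!: nth_equalityI)
  have inner: "eval_arr C (k ys) (map2 \<theta> xss \<tau>s) =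
      coh (operad_comp (k ys) (map k ?xss)) (operad_comp (k ys) ?acted) (concat ?xss)"
    using k_in_Y[OF ys_obj] len' acted k_in_Y_nth[OF xss'] xss' \<tau>s(1)
    by (intro coh_comp_inner) (simp_all add: U_theta_def)
  have Yacted: "operad_comp (k ys) ?acted \<in> Y (length (concat ?xss))"
    using k_in_Y[OF ys_obj] len' acted \<tau>s(1) by (intro operad_comp_in_Y_concat) simp_all
  note Yk = composite_words[OF xss' ys_obj len']
  have "map arity (map k xss) = map length xss"
    using k_in_Y_nth[OF xss] Y_arity by (intro nth_equalityI) auto
  moreover have "map k xss ! s \<in> Y (arity (map k xss ! s))" "arity (map k xss ! s) = length (xss !
      s)"
    if "s < length (map k xss)" for s
    using k_in_Y_nth[OF xss, of s] that Y_arity by auto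
  ultimately have words: "operad_comp (k ys) ?acted = operad_act (operad_comp (k ys) (map k xss))
      ?b"
    using operad_comp_act_inner[of "k ys" "map k xss" \<tau>s] k_in_Y[OF ys_obj] len \<tau>s
    by (simp del: map_map)
  have "eval_arr C (k ys) (map2 (\<cdot>) fs (map2 \<theta> xss \<tau>s)) =
      eval_arr C (k ys) fs \<cdot> eval_arr C (k ys) (map2 \<theta> xss \<tau>s)"
    using k_in_Y[OF ys_obj] len \<tau>s(1) \<theta>s fs by (intro eval_arr_cmp) (simp_all add: Y_def)
  then have "eval_arr C (k ys) (map2 (\<cdot>) fs (map2 \<theta> xss \<tau>s)) \<cdot> \<phi> ?xss ys =
      eval_arr C (k ys) fs \<cdot> eval_arr C (k ys) (map2 \<theta> xss \<tau>s) \<cdot> \<phi> ?xss ys"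
    using phi_typed[OF xss' ys_obj len'] k_in_Y[OF ys_obj] \<theta>s fs len \<tau>s(1)
    by (simp add: Y_def del: map_map)
  also have "eval_arr C (k ys) (map2 \<theta> xss \<tau>s) \<cdot> \<phi> ?xss ys =
      coh (k (concat ?xss)) (operad_comp (k ys) ?acted) (concat ?xss)"
    unfolding inner U_phi_def
    by (rule coh_trans[OF parallel_Y[OF Yk] parallel_Y[OF Yk(2) Yacted] xss'])
  also have "\<dots> = \<phi> xss ys \<cdot> \<theta> (concat xss) ?b"
    using phi_theta[OF xss ys_obj _ b] len concat by (simp add: words)
  finally show ?thesis .
qed

text \<open>
  The content of associativity once the arrows applied last are stripped off. On the left,
  naturality of \<open>\<phi> yss zs\<close> moves the innermost arrows past it; on the right they are already in
  place. The canonical parts agree because both composites of words are equal by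
  \<open>operad_comp_assoc\<close>.
\<close>

lemma phi_assoc:
  assumes xsss: "set (concat (concat xsss)) \<subseteq> obj C" and yss: "set (concat yss) \<subseteq> obj C"
    and zs: "set zs \<subseteq> obj C"
    and len: "length yss = length zs" "length xsss = length zs" "length fss = length zs"
    and fs: "\<And>s. s < length zs \<Longrightarrow> \<forall>f \<in> set (fss ! s). arr f"
      "\<And>s. s < length zs \<Longrightarrow> map src (fss ! s) = map bar (xsss ! s)"
      "\<And>s. s < length zs \<Longrightarrow> map trg (fss ! s) = yss ! s"
  shows "\<phi> yss zs \<cdot> eval_arr C (k (concat yss)) (concat fss) \<cdot> \<phi> (concat xsss) (concat yss) =
    eval_arr C (k zs) (map2 (\<lambda>ys. eval_arr C (k ys)) yss fss) \<cdot>
    eval_arr C (k zs) (map2 \<phi> xsss yss) \<cdot> \<phi> (map concat xsss) zs"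
proof -
  let ?X = "concat xsss" and ?W = "concat yss" and ?F = "concat fss"
  let ?v = "operad_comp (k zs) (map k yss)"
    and ?vs = "map2 operad_comp (map k yss) (map (map k) xsss)"
    and ?A = "eval_arr C (k zs) (map2 (\<lambda>ys. eval_arr C (k ys)) yss fss)"
  have fs_len: "length (fss ! s) = length (yss ! s)" "length (xsss ! s) = length (yss ! s)"
    if "s < length zs" for s
    using map_eq_imp_length_eq[OF fs(2)[OF that]] arg_cong[OF fs(3)[OF that], of length] by simp_all
  have xss: "set (concat (xsss ! s)) \<subseteq> obj C" and ys: "set (yss ! s) \<subseteq> obj C" if "s < length zs"
      for s
    using xsss yss nth_mem[of s xsss] nth_mem[of s yss] that len by (fastforce simp: subset_eq)+
  have F: "\<forall>f \<in> set ?F. arr f"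
    using fs(1) len by (fastforce simp: in_set_conv_nth[of _ fss])
  have "map (map src) fss = map (map bar) xsss" "map (map trg) fss = yss"
    using fs(2,3) len by (auto intro: nth_equalityI)
  then have F_maps: "map src ?F = map bar ?X" "map trg ?F = ?W"
    by (simp_all add: map_concat)
  have F_len: "length ?F = length ?W" "length ?X = length ?W"
    using F_maps by (metis length_map)+
  have concat: "concat (map concat xsss) = concat ?X" by (rule concat_map_concat)
  have obj': "set (concat (map concat xsss)) \<subseteq> obj C" using xsss by (simp only: concat)
  note W = composite_words[OF yss zs len(1)]
  note U = composite_words[OF xsss yss F_len(2)]
  have len': "length (map concat xsss) = length zs" using len by simp
  note V = composite_words[OF obj' zs len']
  have vs: "?vs ! s \<in> Y (length (map concat xsss ! s))" if "s < length zs" for s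
    using composite_words(2)[OF xss ys fs_len(2)] that len by simp
  have natural: "\<phi> yss zs \<cdot> eval_arr C (k ?W) ?F = eval_arr C ?v ?F \<cdot> coh (k ?W) ?v (map bar ?X)"
    using coh_natural[of ?F "k ?W" ?v] F parallel_Y[OF W] F_len F_maps by (simp add: U_phi_def)
  have nested: "eval_arr C ?v ?F = ?A"
    using k_in_Y[OF zs] len k_in_Y_nth[OF yss] fs_len by (intro eval_arr_comp) simp_all
  have par: "parallel (length (map bar ?X)) (k ?W) ?v" using parallel_Y[OF W] F_len by simp
  have bars: "set (map bar ?X) \<subseteq> obj C" using xsss by (auto simp: subset_eq)
  have blocks: "coh (k ?W) ?v (map bar ?X) =
      coh (operad_comp (k ?W) (map k ?X)) (operad_comp ?v (map k ?X)) (concat ?X)"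
    using W F_len k_in_Y_nth[OF xsss] xsss by (intro coh_comp_outer) (simp_all add: kbar_def)
  have Yv: "operad_comp ?v (map k ?X) \<in> Y (length (concat ?X))"
    by (rule operad_comp_in_Y_concat) (use W(2) F_len k_in_Y_nth[OF xsss] in simp_all)
  have words: "operad_comp ?v (map k ?X) = operad_comp (k zs) ?vs"
    using operad_comp_assoc[of "k zs" "map k yss" "map (map k) xsss"] k_in_Y[OF zs] len
      k_in_Y_nth[OF yss] fs_len by (simp add: map_concat)
  have inner: "eval_arr C (k zs) (map2 \<phi> xsss yss) =
      coh (operad_comp (k zs) (map k (map concat xsss))) (operad_comp (k zs) ?vs) (concat (map
          concat xsss))"
    using k_in_Y[OF zs] len k_in_Y_nth[OF obj'] vs obj'
    by (intro coh_comp_inner) (simp_all add: U_phi_def)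
  have Yvs: "operad_comp (k zs) ?vs \<in> Y (length (concat (map concat xsss)))"
    using Yv by (simp only: words concat)
  have "\<phi> yss zs \<cdot> eval_arr C (k ?W) ?F \<cdot> \<phi> ?X ?W = (\<phi> yss zs \<cdot> eval_arr C (k ?W) ?F) \<cdot> \<phi> ?X ?W"
    using phi_typed[OF xsss yss F_len(2)] phi_typed[OF yss zs len(1)] W(1) F F_len F_maps
    by (simp add: kbar_def Y_def)
  also have "\<dots> = (?A \<cdot> coh (k ?W) ?v (map bar ?X)) \<cdot> \<phi> ?X ?W"
    by (simp only: natural nested)
  also have "\<dots> = ?A \<cdot> coh (k ?W) ?v (map bar ?X) \<cdot> \<phi> ?X ?W"
    unfolding nested[symmetric]
    using phi_typed[OF xsss yss F_len(2)] coh_typed[OF par bars] W(2) F F_len F_maps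
    by (simp add: Y_def)
  also have "coh (k ?W) ?v (map bar ?X) \<cdot> \<phi> ?X ?W = coh (k (concat ?X)) (operad_comp ?v (map k
      ?X)) (concat ?X)"
    unfolding blocks U_phi_def by (rule coh_trans[OF parallel_Y[OF U] parallel_Y[OF U(2) Yv] xsss])
  also have "\<dots> = coh (k (concat (map concat xsss))) (operad_comp (k zs) ?vs) (concat (map concat
      xsss))"
    by (simp only: words concat)
  also have "\<dots> = eval_arr C (k zs) (map2 \<phi> xsss yss) \<cdot> \<phi> (map concat xsss) zs"
    unfolding inner unfolding U_phi_def
    by (rule coh_trans[OF parallel_Y[OF V] parallel_Y[OF V(2) Yvs] obj', symmetric])
  finally show ?thesis .
qed

text \<open>
  Naturality of \<open>U_unit C \<kappa> y\<close> moves \<open>f\<close> to the left, and a coherence isomorphism from the word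
  of \<open>xs\<close> to itself remains.
\<close>

lemma phi_unit_left:
  assumes xs: "set xs \<subseteq> obj C" and f: "arr f" "src f = bar xs" "trg f = y"
  shows "U_unit C \<kappa> y \<cdot> eval_arr C (k [y]) [f] \<cdot> \<phi> [xs] [y] = f"
proof -
  have y: "set [y] \<subseteq> obj C" using f by auto
  have unit: "operad_unit \<in> Y (length [y])" by (auto simp: Y_def operad_unit_def)
  note p = parallel_Y[OF k_in_Y[OF y] unit]
  have comp: "operad_comp (k [y]) [k xs] \<in> Y (length xs)"
    using composite_words(2)[of "[xs]" "[y]"] xs y by simp
  have "f \<cdot> coh (k [y]) operad_unit [bar xs] = U_unit C \<kappa> y \<cdot> eval_arr C (k [y]) [f]"
    using coh_natural[of "[f]" "k [y]" operad_unit] p f by (simp add: U_unit_def operad_unit_def)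
  moreover have "coh (k [y]) operad_unit [bar xs] = coh (operad_comp (k [y]) [k xs]) (k xs) xs"
    using coh_comp_outer[of "k [y]" "[xs]" operad_unit "[k xs]" "[bar xs]"] k_in_Y[OF y] unit xs
    by (simp add: kbar_def operad_comp_unit_left)
  moreover have "coh (operad_comp (k [y]) [k xs]) (k xs) xs \<cdot> \<phi> [xs] [y] = ident C (bar xs)"
    using coh_trans[OF parallel_Y[OF k_in_Y[OF xs] comp] parallel_Y[OF comp k_in_Y[OF xs]] xs]
      coh_refl[OF parallel_Y[OF k_in_Y[OF xs] k_in_Y[OF xs]] xs]
    by (simp add: U_phi_def kbar_def)
  moreover have "(U_unit C \<kappa> y \<cdot> eval_arr C (k [y]) [f]) \<cdot> \<phi> [xs] [y] =
      U_unit C \<kappa> y \<cdot> eval_arr C (k [y]) [f] \<cdot> \<phi> [xs] [y]"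
    using phi_typed[of "[xs]" "[y]"] unit_typed[of y] xs y f k_in_Y[OF y]
    by (intro assoc_cmp) (auto simp: Y_def kbar_def)
  moreover have "(f \<cdot> coh (operad_comp (k [y]) [k xs]) (k xs) xs) \<cdot> \<phi> [xs] [y] =
      f \<cdot> coh (operad_comp (k [y]) [k xs]) (k xs) xs \<cdot> \<phi> [xs] [y]"
    using phi_typed[of "[xs]" "[y]"] xs y f coh_typed[OF parallel_Y[OF comp k_in_Y[OF xs]] xs]
      eval_obj_comp[of "k [y]" "[xs]" "[k xs]" "[bar xs]"] k_in_Y[OF y]
    by (intro assoc_cmp) (auto simp: kbar_def)
  ultimately show ?thesis using f by simp
qed

lemma phi_unit_right:
  assumes xs: "set xs \<subseteq> obj C"
  shows "eval_arr C (k xs) (map (U_unit C \<kappa>) xs) \<cdot> \<phi> (map (\<lambda>x. [x]) xs) xs = ident C (bar xs)"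
proof -
  let ?xss = "map (\<lambda>x. [x]) xs"
  have concat: "concat ?xss = xs" by (induction xs) auto
  have comp: "operad_comp (k xs) (map k ?xss) \<in> Y (length xs)"
    using composite_words(2)[of ?xss xs] xs concat by simp
  have kx: "k [xs ! s] \<in> Y (Suc 0)" if "s < length xs" for s
    using k_in_Y[of "[xs ! s]"] xs that nth_mem[OF that] by auto
  have unit: "operad_unit \<in> Y (Suc 0)" by (auto simp: Y_def operad_unit_def)
  have "operad_comp (k xs) (map (\<lambda>x. operad_unit) xs) = k xs"
    using operad_comp_unit_right[OF k_in_Y[OF xs]] by (simp add: map_replicate_const)
  then have "eval_arr C (k xs) (map (U_unit C \<kappa>) xs) = coh (operad_comp (k xs) (map k ?xss)) (k
      xs) xs"
    using coh_comp_inner[of "k xs" ?xss "map k ?xss" "map (\<lambda>x. operad_unit) xs" "map (U_unit C \<kappa>)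
        xs"]
      k_in_Y[OF xs] concat xs kx unit
    by (simp add: U_unit_def)
  then show ?thesis
    using coh_trans[OF parallel_Y[OF k_in_Y[OF xs] comp] parallel_Y[OF comp k_in_Y[OF xs]] xs]
      coh_refl[OF parallel_Y[OF k_in_Y[OF xs] k_in_Y[OF xs]] xs] concat
    by (simp add: U_phi_def kbar_def)
qed

section \<open>The multicategory axioms\<close>

abbreviation U :: "('o, 'o list \<times> 'a) multicat_data" where "U \<equiv> U_multicat C \<kappa>"

lemma U_mhom: "(xs, f) \<in> mhom U ys z \<longleftrightarrow>
    xs = ys \<and> set ys \<subseteq> obj C \<and> arr f \<and> src f = bar ys \<and> trg f = z"
  by (auto simp: U_multicat_def hom_iff)

lemma U_ops:
  "mobj U = obj C" "munit U a = ([a], U_unit C \<kappa> a)"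
  "mact U \<sigma> (xs, f) = (permute_list \<sigma> xs, f \<cdot> \<theta> xs \<sigma>)"
  "mcomp U (ys, g) fs = (concat (map fst fs),
    g \<cdot> eval_arr C (k ys) (map snd fs) \<cdot> \<phi> (map fst fs) ys)"
  by (simp_all add: U_multicat_def)

lemma U_mhomE:
  assumes "m \<in> mhom U xs y"
  obtains f where "m = (xs, f)" "set xs \<subseteq> obj C" "arr f" "src f = bar xs" "trg f = y"
  using assms by (cases m) (auto simp: U_mhom)

text \<open>
  The tags of a list of multimorphisms and their arrows are separated, since the lemmas on
  structure maps speak of lists of arrows.
\<close>

lemma U_mhomsE:
  assumes "ms \<in> mhoms U xss ys"
  obtains fs where "ms = zip xss fs" "length xss = length ys" "length fs = length ys"
    "set (concat xss) \<subseteq> obj C" "set ys \<subseteq> obj C" "\<forall>f \<in> set fs. arr f"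
    "map src fs = map bar xss" "map trg fs = ys"
proof
  have ms: "ms ! s \<in> mhom U (xss ! s) (ys ! s)" if "s < length ys" for s
    using assms that by (simp add: mhoms_def)
  have lens: "length xss = length ys" "length ms = length ys"
    using assms by (auto simp: mhoms_def)
  have nth: "fst (ms ! s) = xss ! s" "set (xss ! s) \<subseteq> obj C" "arr (snd (ms ! s))"
    "src (snd (ms ! s)) = bar (xss ! s)" "trg (snd (ms ! s)) = ys ! s" if "s < length ys" for s
    using ms[OF that] by (cases "ms ! s"; simp add: U_mhom)+
  show "ms = zip xss (map snd ms)"
    using nth(1) lens by (intro nth_equalityI) (auto intro: prod_eqI)
  show "length xss = length ys" "length (map snd ms) = length ys" using lens by simp_all
  show "set (concat xss) \<subseteq> obj C"
    using nth(2) lens by (fastforce simp: in_set_conv_nth[of _ xss])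
  show arrs: "\<forall>f \<in> set (map snd ms). arr f"
    unfolding all_set_conv_all_nth using nth(3) lens by simp
  show "map src (map snd ms) = map bar xss" "map trg (map snd ms) = ys"
    using nth(4,5) lens by (auto intro!: nth_equalityI)
  then have "set ys = trg ` set (map snd ms)" by (metis set_map)
  also have "\<dots> \<subseteq> obj C"
    by (rule image_subsetI, rule trg_obj) (rule arrs[rule_format])
  finally show "set ys \<subseteq> obj C" .
qed

theorem U_multicategory: "multicategory U"
proof
  fix m xs y assume "m \<in> mhom U xs y"
  then show "set xs \<subseteq> mobj U \<and> y \<in> mobj U" by (auto elim!: U_mhomE simp: U_ops)
next
  fix m xs y xs' y' assume "m \<in> mhom U xs y" "m \<in> mhom U xs' y'"
  then show "xs = xs' \<and> y = y'" by (auto elim!: U_mhomE)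
next
  fix a assume "a \<in> mobj U"
  then show "munit U a \<in> mhom U [a] a" by (simp add: U_ops U_mhom unit_typed)
next
  fix m xs y \<sigma> assume m: "m \<in> mhom U xs y" and \<sigma>: "\<sigma> permutes {..<length xs}"
  from m show "mact U \<sigma> m \<in> mhom U (permute_list \<sigma> xs) y"
    by (rule U_mhomE) (use \<sigma> theta_typed[OF _ \<sigma>] in \<open>simp add: U_ops U_mhom\<close>)
next
  fix m ys z ms xss assume m: "m \<in> mhom U ys z" and ms: "ms \<in> mhoms U xss ys"
  from m obtain g where g: "m = (ys, g)" "set ys \<subseteq> obj C" "arr g" "src g = bar ys" "trg g = z"
    by (rule U_mhomE)
  from ms obtain fs where fs: "ms = zip xss fs" "length xss = length ys" "length fs = length ys"
    "set (concat xss) \<subseteq> obj C" "\<forall>f \<in> set fs. arr f"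
    "map src fs = map bar xss" "map trg fs = ys" by (rule U_mhomsE)
  show "mcomp U m ms \<in> mhom U (concat xss) z"
    using fs g phi_typed[of xss ys] k_in_Y[of ys] by (simp add: U_ops U_mhom Y_def kbar_def)
next
  fix m xs y assume "m \<in> mhom U xs y"
  then show "mact U id m = m" by (rule U_mhomE) (simp add: U_ops theta_id)
next
  fix m xs y \<sigma> \<tau>
  assume m: "m \<in> mhom U xs y" and \<sigma>: "\<sigma> permutes {..<length xs}" and \<tau>: "\<tau> permutes {..<length xs}"
  from m obtain f where f: "m = (xs, f)" "set xs \<subseteq> obj C" "arr f" "src f = bar xs"
    by (rule U_mhomE)
  have "\<tau> permutes {..<length (permute_list \<sigma> xs)}" using \<tau> by simp
  from theta_typed[OF permuted_words(1)[OF f(2) \<sigma>] this]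
  show "mact U \<tau> (mact U \<sigma> m) = mact U (\<sigma> \<circ> \<tau>) m"
    using f \<tau> theta_typed[OF f(2) \<sigma>] theta_comp[OF f(2) \<sigma> \<tau>]
    by (simp add: U_ops permute_list_compose)
next
  fix m xs y assume "m \<in> mhom U xs y"
  then show "mcomp U (munit U y) [m] = m"
    by (rule U_mhomE) (simp add: U_ops phi_unit_left)
next
  fix m xs y assume "m \<in> mhom U xs y"
  then show "mcomp U m (map (munit U) xs) = m"
    by (rule U_mhomE) (simp add: U_ops comp_def phi_unit_right concat_map_singleton)
next
  fix m zs w ms yss xsss mss
  assume m: "m \<in> mhom U zs w" and ms: "ms \<in> mhoms U yss zs"
    and len: "length xsss = length yss" "length mss = length yss"
    and mss: "\<And>s. s < length yss \<Longrightarrow> mss ! s \<in> mhoms U (xsss ! s) (yss ! s)"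
  from m obtain h where h: "m = (zs, h)" "set zs \<subseteq> obj C" "arr h" "src h = bar zs" "trg h = w"
    by (rule U_mhomE)
  from ms obtain gs where gs: "ms = zip yss gs" "length yss = length zs" "length gs = length zs"
    "set (concat yss) \<subseteq> obj C" "\<forall>f \<in> set gs. arr f"
    "map src gs = map bar yss" "map trg gs = zs" by (rule U_mhomsE)
  define F where "F s = map snd (mss ! s)" for s
  have F: "mss ! s = zip (xsss ! s) (F s)" "length (xsss ! s) = length (F s)"
      "set (concat (xsss ! s)) \<subseteq> obj C" "\<forall>f \<in> set (F s). arr f"
      "map src (F s) = map bar (xsss ! s)" "map trg (F s) = yss ! s"
    if "s < length zs" for s
  proof -
    have "mss ! s \<in> mhoms U (xsss ! s) (yss ! s)" using mss that gs(2) by simp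
    then obtain fs where fs: "mss ! s = zip (xsss ! s) fs" "length (xsss ! s) = length (yss ! s)"
      "length fs = length (yss ! s)" "set (concat (xsss ! s)) \<subseteq> obj C" "\<forall>f \<in> set fs. arr f"
      "map src fs = map bar (xsss ! s)" "map trg fs = yss ! s" by (rule U_mhomsE)
    then have "F s = fs" by (simp add: F_def)
    with fs show "mss ! s = zip (xsss ! s) (F s)" "length (xsss ! s) = length (F s)"
      "set (concat (xsss ! s)) \<subseteq> obj C" "\<forall>f \<in> set (F s). arr f"
      "map src (F s) = map bar (xsss ! s)" "map trg (F s) = yss ! s" by simp_all
  qed
  define fss where "fss = map F [0..<length zs]"
  have fss: "length fss = length zs" "\<And>s. s < length zs \<Longrightarrow> fss ! s = F s"
    by (simp_all add: fss_def)
  have xsss: "set (concat (concat xsss)) \<subseteq> obj C"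
    using F(3) len gs(2) by (fastforce simp: in_set_conv_nth[of _ xsss])
  have "map (map fst) mss = xsss" "map (map snd) mss = fss"
    using F(1,2) fss len gs(2) by (auto intro!: nth_equalityI)
  then have mss_maps: "map fst (concat mss) = concat xsss" "map snd (concat mss) = concat fss"
    by (simp_all add: map_concat)
  let ?es = "map2 (\<lambda>ys. eval_arr C (k ys)) yss fss" and ?ps = "map2 \<phi> xsss yss"
  have nested: "map2 (mcomp U) ms mss = zip (map concat xsss) (map2 (\<cdot>) gs (map2 (\<cdot>) ?es ?ps))"
    using F(1,2) fss len gs(1-3) by (intro nth_equalityI) (simp_all add: U_ops)
  have ys_nth: "set (yss ! s) \<subseteq> obj C" if "s < length zs" for s
    using gs(2,4) nth_mem[of s yss] that by (auto simp: subset_eq)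
  have es: "arr (?es ! s)" "src (?es ! s) = trg (?ps ! s)" "trg (?es ! s) = bar (yss ! s)"
    "arr (?ps ! s)" "src (?ps ! s) = bar (concat (xsss ! s))"
    if s: "s < length zs" for s
  proof -
    have l: "length (xsss ! s) = length (yss ! s)" "length (F s) = length (yss ! s)"
      using F(2)[OF s] arg_cong[OF F(6)[OF s], of length] by simp_all
    show "arr (?es ! s)" "src (?es ! s) = trg (?ps ! s)" "trg (?es ! s) = bar (yss ! s)"
      "arr (?ps ! s)" "src (?ps ! s) = bar (concat (xsss ! s))"
      using s l F[OF s] fss len gs(2) phi_typed[OF F(3)[OF s] ys_nth[OF s] l(1)]
        k_in_Y[OF ys_nth[OF s]]
      by (simp_all add: Y_def kbar_def)
  qed
  have lens: "length ?es = length zs" "length ?ps = length zs" using fss len gs(2) by simp_all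
  have es_ps: "\<forall>f \<in> set ?es. arr f" "\<forall>f \<in> set ?ps. arr f" "map trg ?ps = map src ?es"
    "map trg ?es = map src gs" "map src ?ps = map bar (map concat xsss)"
    using es lens gs(2,3,6) len by (auto simp del: map_map simp: in_set_conv_nth intro!:
        nth_equalityI)
  let ?ep = "map2 (\<cdot>) ?es ?ps"
  have ep: "\<forall>f \<in> set ?ep. arr f" "map trg ?ep = map src gs" "length ?ep = length zs"
    using es lens gs(2,3,6) by (auto simp del: map_map simp: in_set_conv_nth intro!: nth_equalityI)
  have kzs: "set (vars (k zs)) \<subseteq> {..<length zs}" using k_in_Y[OF h(2)] by (simp add: Y_def)
  let ?e = "eval_arr C (k zs)"
  have "?e (map2 (\<cdot>) gs ?ep) = ?e gs \<cdot> ?e ?es \<cdot> ?e ?ps"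
    using eval_arr_cmp[of "k zs" ?ep gs] eval_arr_cmp[of "k zs" ?ps ?es] kzs es_ps ep gs(5) lens
    by (simp del: map_map)
  then have rhs: "mcomp U m (map2 (mcomp U) ms mss) = (concat (concat xsss),
      h \<cdot> (?e gs \<cdot> ?e ?es \<cdot> ?e ?ps) \<cdot> \<phi> (map concat xsss) zs)"
    using lens gs(2,3) len ep(3) by (simp add: h(1) nested U_ops concat_map_concat)
  have lhs: "mcomp U (mcomp U m ms) (concat mss) = (concat (concat xsss),
      (h \<cdot> ?e gs \<cdot> \<phi> yss zs) \<cdot> eval_arr C (k (concat yss)) (concat fss) \<cdot> \<phi> (concat xsss) (concat
          yss))"
    using gs(2,3) by (simp add: h(1) gs(1) U_ops mss_maps)
  have F_typed: "\<forall>f \<in> set (concat fss). arr f"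
    using F(4) fss by (fastforce simp: in_set_conv_nth[of _ fss])
  have "map (map src) fss = map (map bar) xsss" "map (map trg) fss = yss"
    using F(5,6) fss len gs(2) by (auto intro!: nth_equalityI)
  then have F_maps: "map src (concat fss) = map bar (concat xsss)" "map trg (concat fss) = concat
      yss"
    by (simp_all add: map_concat)
  then have F_len: "length (concat fss) = length (concat yss)" "length (concat xsss) = length
      (concat yss)"
    by (metis length_map)+
  have typed: "arr (?e gs)" "src (?e gs) = eval_obj C (k zs) (map bar yss)" "trg (?e gs) = bar zs"
    "arr (?e ?es)" "src (?e ?es) = trg (?e ?ps)" "trg (?e ?es) = eval_obj C (k zs) (map bar yss)"
    "arr (?e ?ps)" "src (?e ?ps) = eval_obj C (k zs) (map bar (map concat xsss))"
    using kzs gs es_ps lens by (simp_all add: kbar_def del: map_map)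
  have typed': "arr (eval_arr C (k (concat yss)) (concat fss))"
    "src (eval_arr C (k (concat yss)) (concat fss)) = eval_obj C (k (concat yss)) (map bar (concat
        xsss))"
    "trg (eval_arr C (k (concat yss)) (concat fss)) = bar (concat yss)"
    using k_in_Y[OF gs(4)] F_typed F_maps F_len by (simp_all add: Y_def kbar_def)
  have obj': "set (concat (map concat xsss)) \<subseteq> obj C" using xsss by (simp only: concat_map_concat)
  have len': "length (map concat xsss) = length zs" using len gs(2) by simp
  have "\<phi> yss zs \<cdot> eval_arr C (k (concat yss)) (concat fss) \<cdot> \<phi> (concat xsss) (concat yss) =
      ?e ?es \<cdot> ?e ?ps \<cdot> \<phi> (map concat xsss) zs"
    using F(4-6) fss len gs(2) by (intro phi_assoc xsss gs(4) h(2)) simp_all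
  then show "mcomp U (mcomp U m ms) (concat mss) = mcomp U m (map2 (mcomp U) ms mss)"
    unfolding lhs rhs
    using h typed typed' phi_typed[OF gs(4) h(2) gs(2)] phi_typed[OF xsss gs(4) F_len(2)]
      phi_typed[OF obj' h(2) len']
    by (simp del: map_map)
next
  fix m ys z ms xss \<sigma>
  assume m: "m \<in> mhom U ys z" and ms: "ms \<in> mhoms U xss ys" and \<sigma>: "\<sigma> permutes {..<length ys}"
  from m obtain g where g: "m = (ys, g)" "set ys \<subseteq> obj C" "arr g" "src g = bar ys" "trg g = z"
    by (rule U_mhomE)
  from ms obtain fs where fs: "ms = zip xss fs" "length xss = length ys" "length fs = length ys"
    "set (concat xss) \<subseteq> obj C" "\<forall>f \<in> set fs. arr f"
    "map src fs = map bar xss" "map trg fs = ys" by (rule U_mhomsE)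
  let ?b = "block_perm \<sigma> (map length xss)" and ?xss = "permute_list \<sigma> xss" and ?ys = "permute_list
      \<sigma> ys"
  have \<sigma>s: "\<sigma> permutes {..<length xss}" "\<sigma> permutes {..<length fs}" using \<sigma> fs by simp_all
  have b: "?b permutes {..<length (concat xss)}"
    using block_perm_permutes[of \<sigma> "map length xss"] \<sigma>s by (simp add: length_concat)
  have ms': "permute_list \<sigma> ms = zip ?xss (permute_list \<sigma> fs)"
    using fs \<sigma>s by (simp add: permute_list_zip)
  have xss': "set (concat ?xss) \<subseteq> obj C" using fs(4) \<sigma>s by simp
  have len: "length ?xss = length ?ys" using fs by simp
  have "map src (permute_list \<sigma> fs) = map bar ?xss" "map trg (permute_list \<sigma> fs) = ?ys"
    using permute_list_map[OF \<sigma>s(2), of src] permute_list_map[OF \<sigma>s(2), of trg]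
      permute_list_map[OF \<sigma>s(1), of bar] fs by simp_all
  moreover have "\<forall>f \<in> set (permute_list \<sigma> fs). arr f" using fs \<sigma>s by simp
  ultimately have e: "arr (eval_arr C (k ?ys) (permute_list \<sigma> fs))"
    "src (eval_arr C (k ?ys) (permute_list \<sigma> fs)) = eval_obj C (k ?ys) (map bar ?xss)"
    "trg (eval_arr C (k ?ys) (permute_list \<sigma> fs)) = bar ?ys"
    using fs permuted_words(2)[OF g(2) \<sigma>] by (simp_all add: Y_def kbar_def)
  have e': "arr (eval_arr C (k ys) fs)" "src (eval_arr C (k ys) fs) = eval_obj C (k ys) (map bar
      xss)"
    "trg (eval_arr C (k ys) fs) = bar ys"
    using fs k_in_Y[OF g(2)] by (simp_all add: Y_def kbar_def)
  show "mcomp U (mact U \<sigma> m) (permute_list \<sigma> ms) = mact U ?b (mcomp U m ms)"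
    using phi_act_outer[OF fs(4-6) \<sigma>s(2)] fs g e e' theta_typed[OF g(2) \<sigma>] ms'
      phi_typed[OF fs(4) g(2) fs(2)] phi_typed[OF xss' permuted_words(1)[OF g(2) \<sigma>] len]
      theta_typed[OF fs(4) b] permute_list_concat[OF \<sigma>s(1)]
    by (simp add: U_ops)
next
  fix m ys z ms xss \<tau>s
  assume m: "m \<in> mhom U ys z" and ms: "ms \<in> mhoms U xss ys" and len: "length \<tau>s = length xss"
    and \<tau>s: "\<And>s. s < length xss \<Longrightarrow> \<tau>s ! s permutes {..<length (xss ! s)}"
  from m obtain g where g: "m = (ys, g)" "set ys \<subseteq> obj C" "arr g" "src g = bar ys" "trg g = z"
    by (rule U_mhomE)
  from ms obtain fs where fs: "ms = zip xss fs" "length xss = length ys" "length fs = length ys"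
    "set (concat xss) \<subseteq> obj C" "\<forall>f \<in> set fs. arr f"
    "map src fs = map bar xss" "map trg fs = ys" by (rule U_mhomsE)
  let ?b = "sum_perm \<tau>s (map length xss)"
  have b: "?b permutes {..<length (concat xss)}"
    using sum_perm_permutes[of "map length xss" \<tau>s] \<tau>s by (simp add: length_concat)
  have ms': "map2 (mact U) \<tau>s ms =
      zip (map2 permute_list \<tau>s xss) (map2 (\<cdot>) fs (map2 \<theta> xss \<tau>s))"
    using fs len by (intro nth_equalityI) (simp_all add: U_ops)
  have e: "arr (eval_arr C (k ys) fs)" "src (eval_arr C (k ys) fs) = eval_obj C (k ys) (map bar
      xss)"
    "trg (eval_arr C (k ys) fs) = bar ys"
    using fs k_in_Y[OF g(2)] by (simp_all add: Y_def kbar_def)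
  show "mcomp U m (map2 (mact U) \<tau>s ms) = mact U ?b (mcomp U m ms)"
    using phi_act_inner[OF fs(4-7) len \<tau>s] fs(1-3) g e ms' len phi_typed[OF fs(4) g(2) fs(2)]
      theta_typed[OF fs(4) b] concat_permute_list[OF len \<tau>s]
    by (simp add: U_ops)
qed

end

theorem theorem2p2:
  fixes C :: "('o, 'a) smc_data"
    and \<kappa> :: "nat \<Rightarrow> 'o list \<Rightarrow> nat word"
  assumes "symmetric_monoidal_category C"
    and "\<And>n xs. length xs = n \<Longrightarrow> set xs \<subseteq> obj C \<Longrightarrow> \<kappa> n xs \<in> Y n"
  shows "multicategory (U_multicat C \<kappa>) \<and> mobj (U_multicat C \<kappa>) = obj C"
proof
  interpret symmetric_monoidal_category C by (rule assms(1))
  interpret word_choice C \<kappa> by unfold_locales (rule assms(2)[OF refl])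
  show "multicategory (U_multicat C \<kappa>)" by (rule U_multicategory)
  show "mobj (U_multicat C \<kappa>) = obj C" by (rule U_ops)
qed

end
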